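(* Let $f_1,\ldots,f_r$ ($r\ge1$) and $g$ be nonzero elements of $k[x_1,\ldots,x_n]$ with $f_1,\ldots,f_r$ algebraically independent over $k$, and let $A=k[f_1,\ldots,f_r]$, $K=k(f_1,\ldots,f_r)$ and $\omega=df_1\wedge\cdots\wedge df_r$. Let $\mathbf w\in\Gamma^n$ be such that $\deg_{\mathbf w}h\ge0$ for each $h\in A\setminus\{0\}$, and put $M=\deg_{\mathbf w}(\omega\wedge dg)-\deg_{\mathbf w}\omega-\deg_{\mathbf w}g$. Then the following hold for each $\Phi\in A[y]\setminus\{0\}$: (i) Assume that $g^{\mathbf w}$ is algebraic over $K^{\mathbf w}$, and let $a$ and $b$ be the quotient and remainder of $\deg_y\Phi$ divided by $[K^{\mathbf w}(g^{\mathbf w}):K^{\mathbf w}]$, respectively. Then $$\deg_{\mathbf w}\Phi(g)\ge(\deg_y\Phi)\deg_{\mathbf w}g+aM=a\bigl([K^{\mathbf w}(g^{\mathbf w}):K^{\mathbf w}]\deg_{\mathbf w}g+M\bigr)+b\deg_{\mathbf w}g.$$ (ii) If $I(A^{\mathbf w},g^{\mathbf w})$ is a principal ideal and $\deg_{\mathbf w}g\ge0$, then $$\deg_{\mathbf w}\Phi(g)\ge m_{\mathbf w}^g(\Phi)\bigl(\deg_{\mathbf w}^gP(A^{\mathbf w},g^{\mathbf w})+M\bigr).$$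
   Context: $k$ is a field of characteristic zero, $k[\mathbf x]=k[x_1,\ldots,x_n]$ is the polynomial ring in $n\ge1$ variables, and $\Gamma$ is a totally ordered additive group (abelian, with order compatible with addition). For $\mathbf w=(w_1,\ldots,w_n)\in\Gamma^n$, the $\mathbf w$-weighted grading $k[\mathbf x]=\bigoplus_{\gamma\in\Gamma}k[\mathbf x]_\gamma$ is given by letting $k[\mathbf x]_\gamma$ be the $k$-span of the monomials $x_1^{a_1}\cdots x_n^{a_n}$ with $\sum_i a_iw_i=\gamma$. For $f=\sum_\gamma f_\gamma\neq0$ with $f_\gamma\in k[\mathbf x]_\gamma$, $\deg_{\mathbf w}f$ is the maximum of the $\gamma$ with $f_\gamma\ne0$, and $f^{\mathbf w}:=f_\delta$ with $\delta=\deg_{\mathbf w}f$; $\deg_{\mathbf w}0=-\infty$, a symbol less than every element of $\Gamma$. Conventions: $(-\infty)+\gamma=\gamma+(-\infty)=-\infty$ for $\gamma\in\Gamma\cup\{-\infty\}$, and $l\gamma$ denotes the sum of $l$ copies of $\gamma$ for $l\in\mathbb Z_{\ge0}$ and $\gamma\in\Gamma\cup\{-\infty\}$ (so $0\cdot(-\infty)=0$ and $l(-\infty)=-\infty$ for $l\ge1$). For a polynomial $\Phi=\sum_i\phi_iy^i\in k[\mathbf x][y]$ in a variable $y$ (with $\phi_i\in k[\mathbf x]$) and $g\in k[\mathbf x]$, put $\Phi(g)=\sum_i\phi_ig^i$ and $\deg_{\mathbf w}^g\Phi=\max\{\deg_{\mathbf w}(\phi_ig^i)\mid i\in\mathbb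 Z_{\ge0}\}$; $\deg_y\Phi$ is the degree in $y$. Let $\partial_y^i\Phi$ be the $i$-th derivative of $\Phi$ in $y$, and $$m_{\mathbf w}^g(\Phi)=\min\{i\in\mathbb Z_{\ge0}\mid \deg_{\mathbf w}^g\partial_y^i\Phi=\deg_{\mathbf w}\bigl((\partial_y^i\Phi)(g)\bigr)\}.$$ $\Omega_{k[\mathbf x]/k}$ is the module of differentials and $df$ the differential of $f\in k[\mathbf x]$. For $\eta\in\bigwedge^s\Omega_{k[\mathbf x]/k}$, written uniquely as $\eta=\sum_{1\le i_1<\cdots<i_s\le n}h_{i_1,\ldots,i_s}dx_{i_1}\wedge\cdots\wedge dx_{i_s}$ with coefficients in $k[\mathbf x]$, put $\deg_{\mathbf w}\eta=\max\{\deg_{\mathbf w}(h_{i_1,\ldots,i_s})+w_{i_1}+\cdots+w_{i_s}\}$, the maximum over $1\le i_1<\cdots<i_s\le n$; the zero form has degree $-\infty$. For a $k$-subalgebra $A$ of $k[\mathbf x]$ with field of fractions $K$, the initial algebra $A^{\mathbf w}$ is the $k$-subalgebra of $k[\mathbf x]$ generated by $f^{\mathbf w}$ for $f\in A\setminus\{0\}$, and $K^{\mathbf w}$ denotes the field of fractions of $A^{\mathbf w}$ (it depends only on $K$). For an integral domain $R$ and an element $s$ of an integral domain containing $R$, $I(R,s)$ is the kernel of the substitution map $R[y]\to R[s]$, $f\mapsto f(s)$. When $I(R,s)$ is principal, $P(R,s)$ denotes a generator (unique up to units of $R$; it is $0$ if $I(R,s)=0$). *)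

theory Defs
  imports
    "HOL-Library.Poly_Mapping"
    "HOL-Library.Extended"
    "HOL-Computational_Algebra.Polynomial"
    "HOL-Computational_Algebra.Fraction_Field"
    "HOL-Algebra.Generated_Fields"
    "HOL-Algebra.Finite_Extensions"
    "HOL-Algebra.Algebraic_Closure_Type"
begin

text \<open>
  The ring k[x_1,...,x_n]: the variables are indexed by a type of class
  \<open>{finite, linorder}\<close>, so n is the cardinality of that type. Monomials are
  exponent vectors. The order on the index type makes this ring an \<open>idom\<close> and
  fixes the basis of the exterior powers below.
\<close>

type_synonym ('n, 'k) mpol = "('n \<Rightarrow>\<^sub>0 nat) \<Rightarrow>\<^sub>0 'k"

definition scalar :: "'k \<Rightarrow> ('n, 'k::zero) mpol"
  where "scalar c = Poly_Mapping.single 0 c"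

text \<open>For \<open>l = 0\<close> the sum is empty, so \<open>ncopies 0 Minf = 0\<close>.\<close>

definition ncopies :: "nat \<Rightarrow> 'a \<Rightarrow> 'a::comm_monoid_add"
  where "ncopies l c = (\<Sum>_<l. c)"

definition weight :: "('n::finite \<Rightarrow> 'v) \<Rightarrow> ('n \<Rightarrow>\<^sub>0 nat) \<Rightarrow> 'v::linordered_ab_group_add"
  where "weight w m = (\<Sum>i\<in>UNIV. ncopies (Poly_Mapping.lookup m i) (w i))"

definition wcomp ::
  "('n::finite \<Rightarrow> 'v::linordered_ab_group_add) \<Rightarrow> 'v \<Rightarrow> ('n, 'k::comm_ring_1) mpol \<Rightarrow> ('n, 'k) mpol"
  where "wcomp w \<gamma> f =
    (\<Sum>m\<in>{m \<in> Poly_Mapping.keys f. weight w m = \<gamma>}.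
       Poly_Mapping.single m (Poly_Mapping.lookup f m))"

text \<open>
  Degrees live in \<open>'v extended\<close>, where \<open>Minf\<close> is the symbol for minus infinity; the
  value \<open>Pinf\<close> is never attained. Addition with \<open>Minf\<close> follows the usual convention.
  Since \<open>x - Minf = Pinf\<close>, only finite degrees should be subtracted: those of nonzero
  polynomials, and of \<open>df_1 \<and> ... \<and> df_r\<close> for algebraically independent \<open>f_i\<close> in
  characteristic zero.
\<close>

definition wdeg ::
  "('n::finite \<Rightarrow> 'v::linordered_ab_group_add) \<Rightarrow> ('n, 'k::comm_ring_1) mpol \<Rightarrow> 'v extended"
  where "wdeg w f = (if f = 0 then Minf else Fin (Max {\<gamma>. wcomp w \<gamma> f \<noteq> 0}))"

definition init_form ::
  "('n::finite \<Rightarrow> 'v::linordered_ab_group_add) \<Rightarrow> ('n, 'k::comm_ring_1) mpol \<Rightarrow> ('n, 'k) mpol"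
  where "init_form w f = wcomp w (Max {\<gamma>. wcomp w \<gamma> f \<noteq> 0}) f"

text \<open>
  The maximum over all \<open>i\<close> is a maximum of a finite set, since the coefficients vanish
  beyond the degree.
\<close>

definition wdeg_at ::
  "('n::{finite,linorder} \<Rightarrow> 'v::linordered_ab_group_add) \<Rightarrow> ('n, 'k::field_char_0) mpol
    \<Rightarrow> ('n, 'k) mpol poly \<Rightarrow> 'v extended"
  where "wdeg_at w g \<Phi> = Max (range (\<lambda>i. wdeg w (Polynomial.coeff \<Phi> i * g ^ i)))"

definition m_at ::
  "('n::{finite,linorder} \<Rightarrow> 'v::linordered_ab_group_add) \<Rightarrow> ('n, 'k::field_char_0) mpol
    \<Rightarrow> ('n, 'k) mpol poly \<Rightarrow> nat"
  where "m_at w g \<Phi> =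
    (LEAST i. wdeg_at w g ((pderiv ^^ i) \<Phi>) = wdeg w (poly ((pderiv ^^ i) \<Phi>) g))"

text \<open>
  The exterior algebra of the module of differentials is free over the polynomial ring on
  the \<open>dx_I\<close> (factors in increasing order) for sets \<open>I\<close> of indices. A form is
  represented by its coefficient family; an s-form is supported on the \<open>I\<close> with \<open>card I = s\<close>.
\<close>

type_synonym ('n, 'k) form = "'n set \<Rightarrow> ('n, 'k) mpol"

definition pdiff :: "'n \<Rightarrow> ('n, 'k::comm_ring_1) mpol \<Rightarrow> ('n, 'k) mpol"
  where "pdiff i f =
    (\<Sum>m\<in>Poly_Mapping.keys f.
       Poly_Mapping.single (m - Poly_Mapping.single i 1)
         (of_nat (Poly_Mapping.lookup m i) * Poly_Mapping.lookup f m))"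

definition differential :: "('n, 'k::comm_ring_1) mpol \<Rightarrow> ('n, 'k) form"
  where "differential f = (\<lambda>I. \<Sum>i | I = {i}. pdiff i f)"

text \<open>
  The exponent counts the inversions between \<open>I\<close> and \<open>L - I\<close>, so that the sign is the one
  in \<open>dx_I \<and> dx_(L-I) = \<plusminus> dx_L\<close>.
\<close>

definition wedge ::
  "('n::{finite,linorder}, 'k::comm_ring_1) form \<Rightarrow> ('n, 'k) form \<Rightarrow> ('n, 'k) form"
  where "wedge \<eta> \<theta> = (\<lambda>L. \<Sum>I\<in>Pow L.
    (- 1) ^ card {(i, j). i \<in> I \<and> j \<in> L - I \<and> j < i} * \<eta> I * \<theta> (L - I))"

definition one_form :: "('n, 'k::comm_ring_1) form"
  where "one_form = (\<lambda>I. if I = {} then 1 else 0)"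

definition wedge_differentials ::
  "('n::{finite,linorder}, 'k::comm_ring_1) mpol list \<Rightarrow> ('n, 'k) form"
  where "wedge_differentials fs = foldr wedge (map differential fs) one_form"

text \<open>
  For an s-form the sets \<open>I\<close> with \<open>card I \<noteq> s\<close> contribute \<open>Minf\<close>, so they do not affect
  the maximum.
\<close>

definition form_wdeg ::
  "('n::finite \<Rightarrow> 'v::linordered_ab_group_add) \<Rightarrow> ('n, 'k::comm_ring_1) form \<Rightarrow> 'v extended"
  where "form_wdeg w \<eta> = Max (range (\<lambda>I. wdeg w (\<eta> I) + Fin (\<Sum>i\<in>I. w i)))"

inductive_set subalg :: "('n, 'k::comm_ring_1) mpol set \<Rightarrow> ('n, 'k) mpol set"
  for S where
    scalar: "scalar c \<in> subalg S"
  | gen: "f \<in> S \<Longrightarrow> f \<in> subalg S"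
  | add: "f \<in> subalg S \<Longrightarrow> h \<in> subalg S \<Longrightarrow> f + h \<in> subalg S"
  | mult: "f \<in> subalg S \<Longrightarrow> h \<in> subalg S \<Longrightarrow> f * h \<in> subalg S"

definition initial_algebra ::
  "('n::finite \<Rightarrow> 'v::linordered_ab_group_add) \<Rightarrow> ('n, 'k::comm_ring_1) mpol set \<Rightarrow> ('n, 'k) mpol set"
  where "initial_algebra w A = subalg (init_form w ` (A - {0}))"

text \<open>\<open>P\<close> is a polynomial in the variables with indices below \<open>length fs\<close>.\<close>

definition alg_independent :: "('n, 'k::comm_ring_1) mpol list \<Rightarrow> bool"
  where "alg_independent fs \<longleftrightarrow>
    (\<forall>P :: (nat, 'k) mpol.
      (\<forall>m\<in>Poly_Mapping.keys P. Poly_Mapping.keys m \<subseteq> {..<length fs}) \<longrightarrow>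
      (\<Sum>m\<in>Poly_Mapping.keys P.
         scalar (Poly_Mapping.lookup P m) * (\<Prod>i<length fs. (fs ! i) ^ Poly_Mapping.lookup m i)) = 0
      \<longrightarrow> P = 0)"

text \<open>Fields of fractions of subrings are taken inside the fraction field of the ambient domain.\<close>

definition frac_field :: "'a::idom set \<Rightarrow> 'a fract set"
  where "frac_field A = {Fraction_Field.Fract a b | a b. a \<in> A \<and> b \<in> A \<and> b \<noteq> 0}"

definition algebraic_over :: "'a::field set \<Rightarrow> 'a \<Rightarrow> bool"
  where "algebraic_over F x \<longleftrightarrow> ring.algebraic (ring_of_type_algebra :: 'a ring) F x"

text \<open>The degree [F(x) : F]; only meaningful for \<open>x\<close> algebraic over the subfield \<open>F\<close>.\<close>

definition adjoin_degree :: "'a::field set \<Rightarrow> 'a \<Rightarrow> nat"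
  where "adjoin_degree F x =
    ring.dim (ring_of_type_algebra :: 'a ring) F (generate_field ring_of_type_algebra (insert x F))"

definition polys_over :: "'a::zero set \<Rightarrow> 'a poly set"
  where "polys_over R = {p. \<forall>i. Polynomial.coeff p i \<in> R}"

definition subst_kernel :: "'a::comm_ring_1 set \<Rightarrow> 'a \<Rightarrow> 'a poly set"
  where "subst_kernel R s = {p \<in> polys_over R. poly p s = 0}"

definition generates_in :: "'a::comm_ring_1 set \<Rightarrow> 'a poly \<Rightarrow> 'a poly set \<Rightarrow> bool"
  where "generates_in R P I \<longleftrightarrow> P \<in> polys_over R \<and> I = {P * Q | Q. Q \<in> polys_over R}"

definition principal_in :: "'a::comm_ring_1 set \<Rightarrow> 'a poly set \<Rightarrow> bool"
  where "principal_in R I \<longleftrightarrow> (\<exists>P. generates_in R P I)"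

end

theory Submission
  imports Defs
begin

text \<open>
  Let \<delta> be the degree of g and \<mu> = deg^g \<Phi>. The leading part of \<Phi> is the polynomial \<Psi> in y whose
  i-th coefficient is the component of weight \<mu> - i \<delta> of the i-th coefficient of \<Phi> (\<open>ycomp\<close>); its
  coefficients lie in the initial algebra A^w. The component of weight \<mu> of \<Phi>(g) is \<Psi>(g^w)
  (\<open>wcomp_poly\<close>), and leading parts commute with derivatives in y. So the degree of the i-th
  derivative of \<Phi> at g is smaller than its expected value \<mu> - i \<delta> exactly as long as the i-th
  derivative of \<Psi> vanishes at g^w, and the number m defined by the first i without such a drop is
  the multiplicity of g^w as a root of \<Psi> (\<open>m_at_eq_order\<close>).

  Differential forms bound the drop. Since \<omega> \<and> dh = 0 for h in A, the chain rule gives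
  \<omega> \<and> d(\<Phi>(g)) = \<Phi>'(g) \<omega> \<and> dg (\<open>wedge_differential_poly\<close>). As taking differentials does not
  raise degrees, deg \<Phi>(g) is at least deg \<Phi>'(g) + \<delta> + M. After m steps
  there is no drop left, whence deg \<Phi>(g) \<ge> \<mu> + m M (\<open>shestakov_umirbaev_inequality\<close>).

  For M to be meaningful, \<omega> must be nonzero. This is the Jacobian criterion in characteristic zero
  (\<open>jacobian_criterion\<close>): for each j there is a derivation of the polynomial ring that kills all
  f_l with l \<noteq> j but not f_j. It is obtained by starting on k[f_1, ..., f_r] and adjoining
  the variables one at a time (\<open>derivation_extend_step\<close>). Contracting \<omega> with these derivations
  one after the other leaves a nonzero polynomial.

  Both bounds now follow from what a root of multiplicity m costs. A polynomial q of minimal degree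
  over A^w that vanishes at g^w has g^w as a simple root, so \<Psi> is divisible by q^m up to constants
  and m [K^w(g^w) : K^w] \<le> deg \<Psi> (\<open>order_times_degree_le\<close>); hence m \<le> a, and the first bound follows
  from M \<le> 0 and \<mu> \<ge> (deg \<Phi>) \<delta>. If the relations of g^w over A^w are generated by P, then
  \<Psi> = P^m Q with Q over A^w (\<open>generator_power_factor\<close>), and since deg^g is additive on products
  (\<open>wdeg_at_mult\<close>), \<mu> \<ge> m deg^g P, which gives the second bound.
\<close>

section \<open>Weights and degrees\<close>

lemma ncopies_0 [simp]: "ncopies 0 c = 0"
  by (simp add: ncopies_def)

lemma ncopies_Suc: "ncopies (Suc l) c = ncopies l c + c"
  by (simp add: ncopies_def lessThan_Suc add.commute)

lemma ncopies_add: "ncopies (a + b) c = ncopies a c + ncopies b c"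
  by (induction b) (simp_all add: ncopies_Suc add.assoc)

lemma ncopies_plus: "ncopies l (c + d) = ncopies l c + ncopies l d"
  by (simp add: ncopies_def sum.distrib)

lemma ncopies_mult: "ncopies (a * b) c = ncopies a (ncopies b c)"
  by (induction a) (simp_all add: ncopies_Suc ncopies_add add.commute)

lemma ncopies_Fin [simp]: "ncopies l (Fin c) = Fin (ncopies l c)"
  by (induction l) (simp_all add: ncopies_Suc zero_extended_def)

lemma ncopies_Minf: "l > 0 \<Longrightarrow> ncopies l Minf = (Minf :: 'v::ordered_ab_group_add extended)"
proof (induction l)
  case (Suc l)
  then show ?case
    by (cases "l = 0") (simp_all add: ncopies_Suc zero_extended_def)
qed simp

lemma ncopies_uminus: "ncopies l (- c :: 'v::ab_group_add) = - ncopies l c"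
  by (simp add: ncopies_def sum_negf)

lemma ncopies_nonneg: "0 \<le> (c :: 'v::ordered_comm_monoid_add) \<Longrightarrow> 0 \<le> ncopies l c"
  by (simp add: ncopies_def sum_nonneg)

lemma ncopies_antimono_nonpos:
  fixes c :: "'v::ordered_ab_group_add"
  assumes "a \<le> b" "c \<le> 0"
  shows "ncopies b c \<le> ncopies a c"
proof -
  have "ncopies b c = ncopies a c - ncopies (b - a) (- c)"
    using assms(1) ncopies_add[of a "b - a" c] by (simp add: ncopies_uminus)
  then show ?thesis
    using ncopies_nonneg[of "- c" "b - a"] assms(2) by simp
qed

lemma weight_0 [simp]: "weight w 0 = 0"
  by (simp add: weight_def)

lemma weight_add: "weight w (m + m') = weight w m + weight w m'"
  by (simp add: weight_def lookup_add ncopies_add sum.distrib)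

lemma weight_single: "weight w (Poly_Mapping.single i 1) = w i"
proof -
  have "weight w (Poly_Mapping.single i 1) = (\<Sum>j\<in>UNIV. if j = i then w i else 0)"
    unfolding weight_def by (rule sum.cong) (auto simp: lookup_single ncopies_Suc when_def)
  then show ?thesis by simp
qed

lemma lookup_wcomp:
  "Poly_Mapping.lookup (wcomp w \<gamma> f) m = (if weight w m = \<gamma> then Poly_Mapping.lookup f m else 0)"
proof -
  have "Poly_Mapping.lookup (wcomp w \<gamma> f) m =
      (\<Sum>m'\<in>{m \<in> Poly_Mapping.keys f. weight w m = \<gamma>}. if m' = m then Poly_Mapping.lookup f m else 0)"
    unfolding wcomp_def lookup_sum by (rule sum.cong) (auto simp: lookup_single when_def)
  then show ?thesis by (simp add: in_keys_iff)
qed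

lemma keys_wcomp: "Poly_Mapping.keys (wcomp w \<gamma> f) = {m \<in> Poly_Mapping.keys f. weight w m = \<gamma>}"
  by (auto simp: in_keys_iff lookup_wcomp split: if_splits)

lemma wcomp_0 [simp]: "wcomp w \<gamma> 0 = 0"
  by (simp add: wcomp_def)

lemma wcomp_eq_0_iff: "wcomp w \<gamma> f = 0 \<longleftrightarrow> \<gamma> \<notin> weight w ` Poly_Mapping.keys f"
proof -
  have "wcomp w \<gamma> f = 0 \<longleftrightarrow> Poly_Mapping.keys (wcomp w \<gamma> f) = {}" by simp
  then show ?thesis unfolding keys_wcomp by blast
qed

lemma wcomp_add: "wcomp w \<gamma> (f + h) = wcomp w \<gamma> f + wcomp w \<gamma> h"
  by (rule poly_mapping_eqI) (simp add: lookup_wcomp lookup_add)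

lemma wcomp_sum: "wcomp w \<gamma> (sum f I) = (\<Sum>i\<in>I. wcomp w \<gamma> (f i))"
  by (induction I rule: infinite_finite_induct) (simp_all add: wcomp_add)

lemma wcomp_of_nat_mult:
  fixes f :: "('n::finite, 'k::comm_ring_1) mpol"
  shows "wcomp w \<gamma> (of_nat l * f) = of_nat l * wcomp w \<gamma> f"
proof (induction l)
  case (Suc l)
  then show ?case by (simp only: of_nat_Suc distrib_right wcomp_add mult_1)
qed simp

lemma wcomp_homogeneous:
  assumes "\<And>m. m \<in> Poly_Mapping.keys f \<Longrightarrow> weight w m = \<gamma>"
  shows "wcomp w \<gamma> f = f"
  using assms by (intro poly_mapping_eqI) (auto simp: lookup_wcomp in_keys_iff)

lemma wcomp_wcomp: "wcomp w \<gamma> (wcomp w \<gamma> f) = wcomp w \<gamma> f"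
  by (rule wcomp_homogeneous) (simp add: keys_wcomp)

lemma wdeg_eq_Max:
  "f \<noteq> 0 \<Longrightarrow> wdeg w f = Fin (Max (weight w ` Poly_Mapping.keys f))"
proof -
  have "{\<gamma>. wcomp w \<gamma> f \<noteq> 0} = weight w ` Poly_Mapping.keys f"
    by (auto simp: wcomp_eq_0_iff)
  then show "f \<noteq> 0 \<Longrightarrow> wdeg w f = Fin (Max (weight w ` Poly_Mapping.keys f))"
    by (simp add: wdeg_def)
qed

lemma wdeg_0 [simp]: "wdeg w 0 = Minf"
  by (simp add: wdeg_def)

lemma wdeg_eq_Minf_iff [simp]: "wdeg w f = Minf \<longleftrightarrow> f = 0"
  by (simp add: wdeg_def)

lemma wdeg_neq_Pinf [simp]: "wdeg w f \<noteq> Pinf"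
  by (simp add: wdeg_def)

lemma wdeg_nonzeroE:
  assumes "f \<noteq> 0"
  obtains \<gamma> where "wdeg w f = Fin \<gamma>"
  using assms by (simp add: wdeg_def)

lemma wdeg_le_iff: "wdeg w f \<le> Fin \<gamma> \<longleftrightarrow> (\<forall>m\<in>Poly_Mapping.keys f. weight w m \<le> \<gamma>)"
  by (cases "f = 0") (simp_all add: wdeg_eq_Max)

lemma wdeg_eq_Fin_iff: "wdeg w f = Fin \<gamma> \<longleftrightarrow> wdeg w f \<le> Fin \<gamma> \<and> wcomp w \<gamma> f \<noteq> 0"
proof (cases "f = 0")
  case False
  show ?thesis
    unfolding wdeg_eq_Max[OF False] wcomp_eq_0_iff extended.inject less_eq_extended.simps
    using False by (subst Max_eq_iff) (auto simp: Max_le_iff)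
qed simp

lemma init_form_eq: "wdeg w f = Fin \<gamma> \<Longrightarrow> init_form w f = wcomp w \<gamma> f"
  by (auto simp: init_form_def wdeg_def split: if_splits)

lemma wdeg_add_le: "wdeg w f \<le> x \<Longrightarrow> wdeg w h \<le> x \<Longrightarrow> wdeg w (f + h) \<le> x"
  using keys_add[of f h] by (cases x) (auto simp: wdeg_le_iff)

lemma wdeg_sum_le: "(\<And>i. i \<in> I \<Longrightarrow> wdeg w (f i) \<le> x) \<Longrightarrow> wdeg w (sum f I) \<le> x"
  by (induction I rule: infinite_finite_induct) (simp_all add: wdeg_add_le)

lemma wdeg_uminus [simp]: "wdeg w (- f) = wdeg w f"
proof (cases "f = 0")
  case False
  then show ?thesis by (simp add: wdeg_eq_Max)
qed simp

lemma wdeg_wcomp_le: "wdeg w (wcomp w \<gamma> f) \<le> Fin \<gamma>"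
  by (auto simp: wdeg_le_iff keys_wcomp)

text \<open>
  The components of top weight multiply: every other product of components lands in
  a strictly smaller weight, because the order of the value group is compatible with addition.
\<close>

lemma
  fixes f h :: "('n::finite, 'k::comm_ring_1) mpol"
  assumes f: "wdeg w f \<le> Fin \<gamma>" and h: "wdeg w h \<le> Fin \<delta>"
  shows wdeg_mult_le_Fin: "wdeg w (f * h) \<le> Fin (\<gamma> + \<delta>)"
    and wcomp_mult_top: "wcomp w (\<gamma> + \<delta>) (f * h) = wcomp w \<gamma> f * wcomp w \<delta> h"
proof -
  show "wdeg w (f * h) \<le> Fin (\<gamma> + \<delta>)"
    using f h keys_mult[of f h] by (fastforce simp: wdeg_le_iff weight_add intro: add_mono)
  define f' h' where "f' = f - wcomp w \<gamma> f" and "h' = h - wcomp w \<delta> h"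
  have f': "weight w m < \<gamma>" if "m \<in> Poly_Mapping.keys f'" for m
    using f that unfolding f'_def wdeg_le_iff
    by (auto simp: in_keys_iff lookup_minus lookup_wcomp less_le split: if_splits)
  have h': "weight w m < \<delta>" if "m \<in> Poly_Mapping.keys h'" for m
    using h that unfolding h'_def wdeg_le_iff
    by (auto simp: in_keys_iff lookup_minus lookup_wcomp less_le split: if_splits)
  have "f * h = wcomp w \<gamma> f * wcomp w \<delta> h + (wcomp w \<gamma> f * h' + f' * h)"
    unfolding f'_def h'_def by (simp add: algebra_simps)
  moreover have "wcomp w (\<gamma> + \<delta>) (wcomp w \<gamma> f * wcomp w \<delta> h) = wcomp w \<gamma> f * wcomp w \<delta> h"
    using keys_mult[of "wcomp w \<gamma> f" "wcomp w \<delta> h"]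
    by (intro wcomp_homogeneous) (auto simp: keys_wcomp weight_add)
  moreover have "\<gamma> + \<delta> \<notin> weight w ` Poly_Mapping.keys (wcomp w \<gamma> f * h')"
  proof
    assume "\<gamma> + \<delta> \<in> weight w ` Poly_Mapping.keys (wcomp w \<gamma> f * h')"
    then obtain m m' where "m \<in> Poly_Mapping.keys (wcomp w \<gamma> f)" "m' \<in> Poly_Mapping.keys h'"
      "\<gamma> + \<delta> = weight w m + weight w m'"
      using keys_mult[of "wcomp w \<gamma> f" h'] by (auto simp: weight_add)
    then show False using h'[of m'] by (auto simp: keys_wcomp)
  qed
  then have "wcomp w (\<gamma> + \<delta>) (wcomp w \<gamma> f * h') = 0"
    by (simp add: wcomp_eq_0_iff)
  moreover have "\<gamma> + \<delta> \<notin> weight w ` Poly_Mapping.keys (f' * h)"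
  proof
    assume "\<gamma> + \<delta> \<in> weight w ` Poly_Mapping.keys (f' * h)"
    then obtain m m' where "m \<in> Poly_Mapping.keys f'" "m' \<in> Poly_Mapping.keys h"
      "\<gamma> + \<delta> = weight w m + weight w m'"
      using keys_mult[of f' h] by (auto simp: weight_add)
    then show False using f'[of m] h add_less_le_mono[of "weight w m" \<gamma> "weight w m'" \<delta>]
      by (auto simp: wdeg_le_iff)
  qed
  then have "wcomp w (\<gamma> + \<delta>) (f' * h) = 0"
    by (simp add: wcomp_eq_0_iff)
  ultimately show "wcomp w (\<gamma> + \<delta>) (f * h) = wcomp w \<gamma> f * wcomp w \<delta> h"
    by (simp add: wcomp_add)
qed

lemma wdeg_mult:
  fixes f h :: "('n::{finite,linorder}, 'k::idom) mpol"
  shows "wdeg w (f * h) = wdeg w f + wdeg w h"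
proof (cases "f = 0 \<or> h = 0")
  case True
  then show ?thesis
    by (cases "wdeg w f"; cases "wdeg w h") auto
next
  case False
  obtain \<gamma> \<delta> where "wdeg w f = Fin \<gamma>" "wdeg w h = Fin \<delta>"
    using False wdeg_nonzeroE by metis
  then have "wdeg w (f * h) = Fin (\<gamma> + \<delta>)"
    unfolding wdeg_eq_Fin_iff by (simp add: wdeg_mult_le_Fin wcomp_mult_top)
  then show ?thesis using \<open>wdeg w f = Fin \<gamma>\<close> \<open>wdeg w h = Fin \<delta>\<close> by simp
qed

lemma wdeg_1 [simp]: "wdeg w (1 :: ('n::finite, 'k::comm_ring_1) mpol) = Fin 0"
  by (simp add: wdeg_eq_Max)

lemma wdeg_power:
  fixes f :: "('n::{finite,linorder}, 'k::idom) mpol"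
  shows "wdeg w (f ^ i) = ncopies i (wdeg w f)"
  by (induction i) (simp_all add: wdeg_mult ncopies_Suc zero_extended_def add.commute)

lemma wdeg_of_nat_mult:
  fixes f :: "('n::{finite,linorder}, 'k::field_char_0) mpol"
  shows "wdeg w (of_nat (Suc l) * f) = wdeg w f"
proof -
  have nz: "(of_nat (Suc l) :: ('n, 'k) mpol) \<noteq> 0"
    by (rule of_nat_neq_0)
  moreover have "Poly_Mapping.keys (of_nat (Suc l) :: ('n, 'k) mpol) = {0}"
    unfolding single_of_nat[symmetric] keys_single using of_nat_neq_0[where ?'a = 'k, of l] by simp
  ultimately have "wdeg w (of_nat (Suc l) :: ('n, 'k) mpol) = Fin 0"
    by (simp add: wdeg_eq_Max del: of_nat_Suc)
  then show ?thesis
    unfolding wdeg_mult by (simp flip: zero_extended_def)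
qed

section \<open>Leading parts of polynomials in y\<close>

text \<open>
  With y given the weight \<delta>, \<open>ydeg_le\<close> bounds the weighted degree of a polynomial in y by \<mu>, and
  \<open>ycomp\<close> is its homogeneous component of weight \<mu>. Fixing \<mu>, instead of always taking the top
  component, makes \<open>ycomp\<close> compatible with derivatives and products also where the component is 0.
\<close>

definition ydeg_le ::
  "('n::finite \<Rightarrow> 'v::linordered_ab_group_add) \<Rightarrow> 'v \<Rightarrow> 'v \<Rightarrow> ('n, 'k::comm_ring_1) mpol poly \<Rightarrow> bool"
  where "ydeg_le w \<delta> \<mu> \<Phi> \<longleftrightarrow> (\<forall>i. wdeg w (Polynomial.coeff \<Phi> i) \<le> Fin (\<mu> - ncopies i \<delta>))"

definition ycomp ::
  "('n::finite \<Rightarrow> 'v::linordered_ab_group_add) \<Rightarrow> 'v \<Rightarrow> 'v \<Rightarrow> ('n, 'k::comm_ring_1) mpol poly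
    \<Rightarrow> ('n, 'k) mpol poly"
  where "ycomp w \<delta> \<mu> \<Phi> = Abs_poly (\<lambda>i. wcomp w (\<mu> - ncopies i \<delta>) (Polynomial.coeff \<Phi> i))"

lemma coeff_ycomp:
  "Polynomial.coeff (ycomp w \<delta> \<mu> \<Phi>) i = wcomp w (\<mu> - ncopies i \<delta>) (Polynomial.coeff \<Phi> i)"
  unfolding ycomp_def by (subst coeff_Abs_poly[of "Polynomial.degree \<Phi>"]) (simp_all add: coeff_eq_0)

lemma degree_ycomp_le: "Polynomial.degree (ycomp w \<delta> \<mu> \<Phi>) \<le> Polynomial.degree \<Phi>"
  by (rule degree_le) (simp add: coeff_ycomp coeff_eq_0)

lemma ycomp_ycomp: "ycomp w \<delta> \<mu> (ycomp w \<delta> \<mu> \<Phi>) = ycomp w \<delta> \<mu> \<Phi>"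
  by (rule poly_eqI) (simp add: coeff_ycomp wcomp_wcomp)

lemma ydeg_le_ycomp: "ydeg_le w \<delta> \<mu> (ycomp w \<delta> \<mu> \<Phi>)"
  by (simp add: ydeg_le_def coeff_ycomp wdeg_wcomp_le)

lemma extended_plus_le_Fin_iff:
  "x + Fin (d :: 'v::ordered_ab_group_add) \<le> Fin \<mu> \<longleftrightarrow> x \<le> Fin (\<mu> - d)"
  "x + Fin d = Fin \<mu> \<longleftrightarrow> x = Fin (\<mu> - d)"
  by (cases x; simp add: algebra_simps; fail)+

context
  fixes w :: "'n::{finite,linorder} \<Rightarrow> 'v::linordered_ab_group_add"
    and g :: "('n, 'k::field_char_0) mpol" and \<delta> :: 'v
  assumes g: "wdeg w g = Fin \<delta>"
begin

lemma wdeg_summand: "wdeg w (c * g ^ i) = wdeg w c + Fin (ncopies i \<delta>)"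
  by (simp add: wdeg_mult wdeg_power g)

lemma finite_wdeg_summands: "finite (range (\<lambda>i. wdeg w (Polynomial.coeff \<Phi> i * g ^ i)))"
proof (rule finite_subset)
  show "range (\<lambda>i. wdeg w (Polynomial.coeff \<Phi> i * g ^ i))
    \<subseteq> insert Minf ((\<lambda>i. wdeg w (Polynomial.coeff \<Phi> i * g ^ i)) ` {..Polynomial.degree \<Phi>})"
  proof
    fix x
    assume "x \<in> range (\<lambda>i. wdeg w (Polynomial.coeff \<Phi> i * g ^ i))"
    then obtain i where "x = wdeg w (Polynomial.coeff \<Phi> i * g ^ i)" by blast
    then show "x \<in> insert Minf ((\<lambda>i. wdeg w (Polynomial.coeff \<Phi> i * g ^ i)) ` {..Polynomial.degree \<Phi>})"
      by (cases "i \<le> Polynomial.degree \<Phi>") (auto simp: coeff_eq_0 not_le)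
  qed
qed simp

lemma wdeg_at_le_iff: "wdeg_at w g \<Phi> \<le> Fin \<mu> \<longleftrightarrow> ydeg_le w \<delta> \<mu> \<Phi>"
  unfolding wdeg_at_def ydeg_le_def using finite_wdeg_summands[of \<Phi>]
  by (subst Max_le_iff) (auto simp: wdeg_summand extended_plus_le_Fin_iff)

lemma wdeg_at_eq_iff: "wdeg_at w g \<Phi> = Fin \<mu> \<longleftrightarrow> ydeg_le w \<delta> \<mu> \<Phi> \<and> ycomp w \<delta> \<mu> \<Phi> \<noteq> 0"
proof -
  have "wdeg_at w g \<Phi> = Fin \<mu> \<longleftrightarrow> wdeg_at w g \<Phi> \<le> Fin \<mu> \<and>
      (\<exists>i. wdeg w (Polynomial.coeff \<Phi> i) = Fin (\<mu> - ncopies i \<delta>))"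
  proof -
    have "wdeg_at w g \<Phi> = Fin \<mu> \<longleftrightarrow> wdeg_at w g \<Phi> \<le> Fin \<mu> \<and>
      Fin \<mu> \<in> range (\<lambda>i. wdeg w (Polynomial.coeff \<Phi> i * g ^ i))"
      unfolding wdeg_at_def using finite_wdeg_summands[of \<Phi>]
      by (subst Max_eq_iff, simp, simp, subst Max_le_iff) auto
    moreover have "Fin \<mu> \<in> range (\<lambda>i. wdeg w (Polynomial.coeff \<Phi> i * g ^ i)) \<longleftrightarrow>
      (\<exists>i. wdeg w (Polynomial.coeff \<Phi> i) + Fin (ncopies i \<delta>) = Fin \<mu>)"
      unfolding wdeg_summand by (auto simp: image_iff eq_commute)
    ultimately show ?thesis
      unfolding extended_plus_le_Fin_iff by simp
  qed
  then show ?thesis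
    unfolding wdeg_at_le_iff wdeg_eq_Fin_iff ydeg_le_def poly_eq_iff coeff_ycomp by auto
qed

lemma wdeg_at_nonzeroE:
  assumes "\<Phi> \<noteq> 0"
  obtains \<mu> where "wdeg_at w g \<Phi> = Fin \<mu>"
proof (cases "wdeg_at w g \<Phi>")
  case Pinf
  have "Pinf \<in> range (\<lambda>i. wdeg w (Polynomial.coeff \<Phi> i * g ^ i))"
    using Max_in[OF finite_wdeg_summands[of \<Phi>]] unfolding wdeg_at_def[symmetric] Pinf by blast
  then show ?thesis
  proof
    fix i
    assume "Pinf = wdeg w (Polynomial.coeff \<Phi> i * g ^ i)"
    from this[symmetric] show ?thesis by simp
  qed
next
  case Minf
  have "wdeg w (lead_coeff \<Phi> * g ^ Polynomial.degree \<Phi>) \<le> wdeg_at w g \<Phi>"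
    unfolding wdeg_at_def using finite_wdeg_summands[of \<Phi>] by (intro Max_ge) auto
  moreover have "g \<noteq> 0" using g by auto
  ultimately show ?thesis using Minf assms by simp
qed (use that in blast)

text \<open>
  Every summand of \<Phi>(g) has weight at most \<mu>, and its component of weight \<mu> is the product of
  the top components of its factors. Thus \<Phi>(g) has degree smaller than \<mu> exactly if these
  components cancel, that is, if the leading part vanishes at the initial form of g.
\<close>

lemma
  assumes "ydeg_le w \<delta> \<mu> \<Phi>"
  shows wdeg_poly_le: "wdeg w (poly \<Phi> g) \<le> Fin \<mu>"
    and wcomp_poly: "wcomp w \<mu> (poly \<Phi> g) = poly (ycomp w \<delta> \<mu> \<Phi>) (init_form w g)"
proof -
  have c: "wdeg w (Polynomial.coeff \<Phi> i) \<le> Fin (\<mu> - ncopies i \<delta>)" for i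
    using assms by (simp add: ydeg_le_def)
  have gi: "wdeg w (g ^ i) = Fin (ncopies i \<delta>)" for i by (simp add: wdeg_power g)
  have top: "wcomp w (ncopies i \<delta>) (g ^ i) = init_form w g ^ i" for i
  proof (induction i)
    case 0
    show ?case using wcomp_homogeneous[of "1 :: ('n, 'k) mpol" w 0] by simp
  next
    case (Suc i)
    have "wcomp w (\<delta> + ncopies i \<delta>) (g * g ^ i) = wcomp w \<delta> g * wcomp w (ncopies i \<delta>) (g ^ i)"
      by (rule wcomp_mult_top) (simp_all add: g gi)
    then show ?case by (simp add: ncopies_Suc add.commute Suc.IH init_form_eq[OF g])
  qed
  have s: "wdeg w (Polynomial.coeff \<Phi> i * g ^ i) \<le> Fin \<mu>" for i
    unfolding wdeg_summand extended_plus_le_Fin_iff using c by simp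
  show "wdeg w (poly \<Phi> g) \<le> Fin \<mu>"
    unfolding poly_altdef by (rule wdeg_sum_le) (rule s)
  have "wcomp w \<mu> (Polynomial.coeff \<Phi> i * g ^ i)
      = Polynomial.coeff (ycomp w \<delta> \<mu> \<Phi>) i * init_form w g ^ i" for i
    using wcomp_mult_top[OF c[of i], of "g ^ i" "ncopies i \<delta>"] by (simp add: gi top coeff_ycomp)
  then have "wcomp w \<mu> (poly \<Phi> g)
      = (\<Sum>i\<le>Polynomial.degree \<Phi>. Polynomial.coeff (ycomp w \<delta> \<mu> \<Phi>) i * init_form w g ^ i)"
    unfolding poly_altdef wcomp_sum by simp
  also have "\<dots> = poly (ycomp w \<delta> \<mu> \<Phi>) (init_form w g)"
    unfolding poly_altdef using degree_ycomp_le[of w \<delta> \<mu> \<Phi>]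
    by (intro sum.mono_neutral_right) (auto simp: coeff_eq_0)
  finally show "wcomp w \<mu> (poly \<Phi> g) = poly (ycomp w \<delta> \<mu> \<Phi>) (init_form w g)" .
qed

end

text \<open>
  Differentiation in y shifts the coefficients down by one index, and the integer factor has weight
  0; so the expected degree goes down by exactly the weight \<delta> of y.
\<close>

lemma
  fixes \<Phi> :: "('n::{finite,linorder}, 'k::field_char_0) mpol poly"
  shows ycomp_pderiv: "ycomp w \<delta> (\<mu> - \<delta>) (pderiv \<Phi>) = pderiv (ycomp w \<delta> \<mu> \<Phi>)"
    and ydeg_le_pderiv: "ydeg_le w \<delta> \<mu> \<Phi> \<Longrightarrow> ydeg_le w \<delta> (\<mu> - \<delta>) (pderiv \<Phi>)"
proof -
  show "ycomp w \<delta> (\<mu> - \<delta>) (pderiv \<Phi>) = pderiv (ycomp w \<delta> \<mu> \<Phi>)"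
    by (rule poly_eqI) (simp only: coeff_ycomp coeff_pderiv ncopies_Suc wcomp_of_nat_mult diff_diff_eq add.commute)
  show "ydeg_le w \<delta> (\<mu> - \<delta>) (pderiv \<Phi>)" if "ydeg_le w \<delta> \<mu> \<Phi>"
    unfolding ydeg_le_def coeff_pderiv wdeg_of_nat_mult
  proof
    fix i
    have "\<mu> - \<delta> - ncopies i \<delta> = \<mu> - ncopies (Suc i) \<delta>" by (simp add: ncopies_Suc algebra_simps)
    moreover have "wdeg w (Polynomial.coeff \<Phi> (Suc i)) \<le> Fin (\<mu> - ncopies (Suc i) \<delta>)"
      using that unfolding ydeg_le_def by blast
    ultimately show "wdeg w (Polynomial.coeff \<Phi> (Suc i)) \<le> Fin (\<mu> - \<delta> - ncopies i \<delta>)"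
      by (simp only:)
  qed
qed

lemma
  fixes \<Phi> :: "('n::{finite,linorder}, 'k::field_char_0) mpol poly"
  shows ycomp_pderivs: "ycomp w \<delta> (\<mu> - ncopies i \<delta>) ((pderiv ^^ i) \<Phi>) = (pderiv ^^ i) (ycomp w \<delta> \<mu> \<Phi>)"
    and ydeg_le_pderivs: "ydeg_le w \<delta> \<mu> \<Phi> \<Longrightarrow> ydeg_le w \<delta> (\<mu> - ncopies i \<delta>) ((pderiv ^^ i) \<Phi>)"
proof (induction i)
  case (Suc i)
  have *: "\<mu> - ncopies (Suc i) \<delta> = \<mu> - ncopies i \<delta> - \<delta>" by (simp add: ncopies_Suc algebra_simps)
  { case 1
    show ?case unfolding * using Suc(1) by (simp add: ycomp_pderiv) }
  { case 2
    then show ?case unfolding * using Suc(2) by (simp add: ydeg_le_pderiv) }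
qed simp_all

lemma
  fixes \<Phi> \<Psi> :: "('n::{finite,linorder}, 'k::field_char_0) mpol poly"
  assumes "ydeg_le w \<delta> \<mu> \<Phi>" "ydeg_le w \<delta> \<nu> \<Psi>"
  shows ydeg_le_mult: "ydeg_le w \<delta> (\<mu> + \<nu>) (\<Phi> * \<Psi>)"
    and ycomp_mult: "ycomp w \<delta> (\<mu> + \<nu>) (\<Phi> * \<Psi>) = ycomp w \<delta> \<mu> \<Phi> * ycomp w \<delta> \<nu> \<Psi>"
proof -
  have *: "(\<mu> - ncopies j \<delta>) + (\<nu> - ncopies (i - j) \<delta>) = \<mu> + \<nu> - ncopies i \<delta>" if "j \<le> i" for i j
    using ncopies_add[of j "i - j" \<delta>] that by (simp add: algebra_simps)
  have l: "wdeg w (Polynomial.coeff \<Phi> j * Polynomial.coeff \<Psi> (i - j)) \<le> Fin (\<mu> + \<nu> - ncopies i \<delta>)"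
    and c: "wcomp w (\<mu> + \<nu> - ncopies i \<delta>) (Polynomial.coeff \<Phi> j * Polynomial.coeff \<Psi> (i - j))
      = wcomp w (\<mu> - ncopies j \<delta>) (Polynomial.coeff \<Phi> j) *
        wcomp w (\<nu> - ncopies (i - j) \<delta>) (Polynomial.coeff \<Psi> (i - j))" if "j \<le> i" for i j
    unfolding *[OF that, symmetric] using assms
    by (intro wdeg_mult_le_Fin wcomp_mult_top; simp add: ydeg_le_def)+
  show "ydeg_le w \<delta> (\<mu> + \<nu>) (\<Phi> * \<Psi>)"
    unfolding ydeg_le_def coeff_mult by (intro allI wdeg_sum_le l) simp
  show "ycomp w \<delta> (\<mu> + \<nu>) (\<Phi> * \<Psi>) = ycomp w \<delta> \<mu> \<Phi> * ycomp w \<delta> \<nu> \<Psi>"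
    by (rule poly_eqI) (simp add: coeff_ycomp coeff_mult wcomp_sum c)
qed

lemma wdeg_at_mult:
  fixes \<Phi> \<Psi> :: "('n::{finite,linorder}, 'k::field_char_0) mpol poly"
  assumes "wdeg w g = Fin \<delta>" "wdeg_at w g \<Phi> = Fin \<mu>" "wdeg_at w g \<Psi> = Fin \<nu>"
  shows "wdeg_at w g (\<Phi> * \<Psi>) = Fin (\<mu> + \<nu>)"
  using assms by (simp add: wdeg_at_eq_iff ydeg_le_mult ycomp_mult)

section \<open>The exterior algebra\<close>

text \<open>
  The sign in dx_I \<and> dx_J = \<plusminus> dx_(I \<union> J) for disjoint I and J. All identities of the exterior
  algebra below rest on its being multiplicative in each of its arguments.
\<close>

definition inv_sign :: "'n::linorder set \<Rightarrow> 'n set \<Rightarrow> 'a::comm_ring_1"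
  where "inv_sign I J = (- 1) ^ card {(i, j). i \<in> I \<and> j \<in> J \<and> j < i}"

lemma finite_inversions: "finite {(i, j). i \<in> (I :: 'n::{finite,linorder} set) \<and> j \<in> J \<and> j < i}"
  by (rule finite_subset[of _ "UNIV \<times> UNIV"]) auto

lemma inv_sign_Un_left:
  fixes I :: "'n::{finite,linorder} set"
  assumes "I \<inter> J = {}"
  shows "inv_sign (I \<union> J) K = inv_sign I K * inv_sign J K"
proof -
  have "{(i, j). i \<in> I \<union> J \<and> j \<in> K \<and> j < i}
      = {(i, j). i \<in> I \<and> j \<in> K \<and> j < i} \<union> {(i, j). i \<in> J \<and> j \<in> K \<and> j < i}"
    by auto
  moreover have "{(i, j). i \<in> I \<and> j \<in> K \<and> j < i} \<inter> {(i, j). i \<in> J \<and> j \<in> K \<and> j < i} = {}"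
    using assms by auto
  ultimately show ?thesis
    by (simp add: inv_sign_def card_Un_disjoint finite_inversions power_add)
qed

lemma inv_sign_Un_right:
  fixes I :: "'n::{finite,linorder} set"
  assumes "J \<inter> K = {}"
  shows "inv_sign I (J \<union> K) = inv_sign I J * inv_sign I K"
proof -
  have "{(i, j). i \<in> I \<and> j \<in> J \<union> K \<and> j < i}
      = {(i, j). i \<in> I \<and> j \<in> J \<and> j < i} \<union> {(i, j). i \<in> I \<and> j \<in> K \<and> j < i}"
    by auto
  moreover have "{(i, j). i \<in> I \<and> j \<in> J \<and> j < i} \<inter> {(i, j). i \<in> I \<and> j \<in> K \<and> j < i} = {}"
    using assms by auto
  ultimately show ?thesis
    by (simp add: inv_sign_def card_Un_disjoint finite_inversions power_add)
qed

lemma inv_sign_singletons: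
  assumes "i \<noteq> j"
  shows "inv_sign {i} {j} * inv_sign {j} {i} = (- 1 :: 'a::comm_ring_1)"
proof -
  have "{(i', j'). i' \<in> {i} \<and> j' \<in> {j} \<and> j' < i'} = (if j < i then {(i, j)} else {})" for i j :: 'b
    by auto
  then show ?thesis using assms by (simp add: inv_sign_def)
qed

lemma inv_sign_square: "inv_sign I J * inv_sign I J = (1 :: 'a::comm_ring_1)"
  by (simp add: inv_sign_def flip: power_add)

lemma inv_sign_empty [simp]: "inv_sign {} J = 1" "inv_sign I {} = 1"
  by (simp_all add: inv_sign_def)

lemma inv_sign_cases: "inv_sign I J = (1 :: 'a::comm_ring_1) \<or> inv_sign I J = (- 1 :: 'a)"
  unfolding inv_sign_def by (cases "even (card {(i, j). i \<in> I \<and> j \<in> J \<and> j < i})") auto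

lemma wedge_eq: "wedge \<eta> \<theta> L = (\<Sum>I\<in>Pow L. inv_sign I (L - I) * \<eta> I * \<theta> (L - I))"
  by (simp add: wedge_def inv_sign_def)

text \<open>
  Both sides are sums over the ordered partitions of L into three blocks, and by multiplicativity both
  signs count the inversions between each pair of blocks.
\<close>

lemma wedge_assoc: "wedge (wedge \<eta> \<theta>) \<zeta> = wedge \<eta> (wedge \<theta> \<zeta>)"
proof
  fix L
  let ?a = "\<lambda>J I. inv_sign J (L - J) * (inv_sign I (J - I) * \<eta> I * \<theta> (J - I)) * \<zeta> (L - J)"
  let ?b = "\<lambda>I J. inv_sign I (L - I) * \<eta> I * (inv_sign J (L - I - J) * \<theta> J * \<zeta> (L - I - J))"
  have "wedge (wedge \<eta> \<theta>) \<zeta> L = (\<Sum>J\<in>Pow L. \<Sum>I\<in>Pow J. ?a J I)"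
    by (simp add: wedge_eq sum_distrib_left sum_distrib_right)
  also have "\<dots> = (\<Sum>(J, I)\<in>(SIGMA J:Pow L. Pow J). ?a J I)"
    by (rule sum.Sigma) simp_all
  also have "\<dots> = (\<Sum>(I, J)\<in>(SIGMA I:Pow L. Pow (L - I)). ?b I J)"
  proof (rule sum.reindex_bij_witness[of _ "\<lambda>(I, J). (I \<union> J, I)" "\<lambda>(J, I). (I, J - I)"])
    fix x assume "x \<in> (SIGMA J:Pow L. Pow J)"
    then obtain J I where x: "x = (J, I)" and sub: "I \<subseteq> J" "J \<subseteq> L" by auto
    have e: "L - I = (J - I) \<union> (L - J)" "L - I - (J - I) = L - J" "J = I \<union> (J - I)"
      using sub by auto
    have s1: "inv_sign I (L - I) = inv_sign I (J - I) * (inv_sign I (L - J) :: ('a, 'b) mpol)"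
      unfolding e(1) by (rule inv_sign_Un_right) auto
    have s2: "inv_sign J (L - J) = inv_sign I (L - J) * (inv_sign (J - I) (L - J) :: ('a, 'b) mpol)"
      by (subst e(3), rule inv_sign_Un_left) auto
    show "(case case x of (J, I) \<Rightarrow> (I, J - I) of (I, J) \<Rightarrow> ?b I J) = (case x of (J, I) \<Rightarrow> ?a J I)"
      unfolding x prod.case e(2) s1 s2 by (simp add: algebra_simps)
  qed auto
  also have "\<dots> = (\<Sum>I\<in>Pow L. \<Sum>J\<in>Pow (L - I). ?b I J)"
    by (rule sum.Sigma[symmetric]) simp_all
  also have "\<dots> = wedge \<eta> (wedge \<theta> \<zeta>) L"
    by (simp add: wedge_eq sum_distrib_left)
  finally show "wedge (wedge \<eta> \<theta>) \<zeta> L = wedge \<eta> (wedge \<theta> \<zeta>) L" .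
qed

lemma wedge_add_right: "wedge \<eta> (\<lambda>I. \<theta> I + \<zeta> I) = (\<lambda>L. wedge \<eta> \<theta> L + wedge \<eta> \<zeta> L)"
  by (rule ext) (simp add: wedge_eq distrib_left sum.distrib)

lemma wedge_scale_right: "wedge \<eta> (\<lambda>I. c * \<theta> I) = (\<lambda>L. c * wedge \<eta> \<theta> L)"
  by (rule ext) (simp add: wedge_eq sum_distrib_left ac_simps)

lemma wedge_scale_left: "wedge (\<lambda>I. c * \<eta> I) \<theta> = (\<lambda>L. c * wedge \<eta> \<theta> L)"
  by (rule ext) (simp add: wedge_eq sum_distrib_left ac_simps)

lemma wedge_0_right: "wedge \<eta> (\<lambda>I. 0) = (\<lambda>L. 0)"
  by (rule ext) (simp add: wedge_eq)

lemma wedge_0_left: "wedge (\<lambda>I. 0) \<eta> = (\<lambda>L. 0)"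
  by (rule ext) (simp add: wedge_eq)

lemma wedge_one_left: "wedge one_form \<eta> = \<eta>"
proof
  fix L
  have "wedge one_form \<eta> L = (\<Sum>I\<in>Pow L. if I = {} then \<eta> L else 0)"
    unfolding wedge_eq by (rule sum.cong) (auto simp: one_form_def)
  then show "wedge one_form \<eta> L = \<eta> L" by simp
qed

lemma wedge_one_right: "wedge \<eta> one_form = \<eta>"
proof
  fix L
  have "wedge \<eta> one_form L = (\<Sum>I\<in>Pow L. if I = L then \<eta> L else 0)"
    unfolding wedge_eq by (rule sum.cong) (auto simp: one_form_def)
  then show "wedge \<eta> one_form L = \<eta> L" by simp
qed

definition is_1form :: "('n, 'k::comm_ring_1) form \<Rightarrow> bool"
  where "is_1form \<alpha> \<longleftrightarrow> (\<forall>I. card I \<noteq> 1 \<longrightarrow> \<alpha> I = 0)"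

lemma is_1form_differential: "is_1form (differential f)"
  unfolding is_1form_def
proof (intro allI impI)
  fix I :: "'a set"
  assume "card I \<noteq> 1"
  then have "{i. I = {i}} = {}" by auto
  then show "differential f I = 0" by (simp add: differential_def)
qed

lemma differential_singleton: "differential f {i} = pdiff i f"
proof -
  have "{j. {i} = {j}} = {i}" by auto
  then show ?thesis by (simp add: differential_def)
qed

lemma wedge_anticommute:
  assumes "is_1form \<alpha>" "is_1form \<beta>"
  shows "wedge \<beta> \<alpha> = (\<lambda>L. - 1 * wedge \<alpha> \<beta> L)"
proof
  fix L
  have "wedge \<beta> \<alpha> L = (\<Sum>I\<in>Pow L. inv_sign (L - I) I * \<beta> (L - I) * \<alpha> I)"
    unfolding wedge_eq
    by (rule sum.reindex_bij_witness[of _ "\<lambda>I. L - I" "\<lambda>I. L - I"]) (auto simp: double_diff)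
  also have "\<dots> = (\<Sum>I\<in>Pow L. - (inv_sign I (L - I) * \<alpha> I * \<beta> (L - I)))"
  proof (rule sum.cong)
    fix I assume "I \<in> Pow L"
    show "inv_sign (L - I) I * \<beta> (L - I) * \<alpha> I = - (inv_sign I (L - I) * \<alpha> I * \<beta> (L - I))"
    proof (cases "card I = 1 \<and> card (L - I) = 1")
      case True
      then obtain i j where ij: "I = {i}" "L - I = {j}" by (meson card_1_singletonE)
      then have "i \<noteq> j" by auto
      from inv_sign_singletons[OF this, where ?'a = "('a, 'b) mpol"]
      have "inv_sign {j} {i} = - (inv_sign {i} {j} :: ('a, 'b) mpol)"
        using inv_sign_square[of "{i}" "{j}", where ?'a = "('a, 'b) mpol"]
        by (metis (no_types, lifting) mult.assoc mult.commute mult_1_left mult_minus1)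
      then show ?thesis unfolding ij(2) unfolding ij(1) by (simp add: ac_simps)
    next
      case False
      then have "\<alpha> I = 0 \<or> \<beta> (L - I) = 0" using assms by (auto simp: is_1form_def)
      then show ?thesis by auto
    qed
  qed simp
  also have "\<dots> = - 1 * wedge \<alpha> \<beta> L" by (simp add: wedge_eq sum_negf)
  finally show "wedge \<beta> \<alpha> L = - 1 * wedge \<alpha> \<beta> L" .
qed

lemma wedge_1form_self:
  fixes \<alpha> :: "('n::{finite,linorder}, 'k::field_char_0) form"
  assumes "is_1form \<alpha>"
  shows "wedge \<alpha> \<alpha> = (\<lambda>_. 0)"
proof
  fix L
  have "wedge \<alpha> \<alpha> L = - 1 * wedge \<alpha> \<alpha> L"
    using fun_cong[OF wedge_anticommute[OF assms assms], of L] .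
  then have "2 * wedge \<alpha> \<alpha> L = 0"
    by (simp add: eq_neg_iff_add_eq_0)
  then show "wedge \<alpha> \<alpha> L = 0" by simp
qed

lemma wedge_differentials_simps:
  "wedge_differentials [] = one_form"
  "wedge_differentials (f # fs) = wedge (differential f) (wedge_differentials fs)"
  by (simp_all add: wedge_differentials_def)

lemma wedge_differentials_commute:
  assumes "is_1form \<beta>"
  shows "wedge (wedge_differentials fs) \<beta> = (\<lambda>L. (- 1) ^ length fs * wedge \<beta> (wedge_differentials fs) L)"
proof (induction fs)
  case Nil
  then show ?case by (simp add: wedge_differentials_simps wedge_one_left wedge_one_right)
next
  case (Cons f fs)
  have "wedge (wedge_differentials (f # fs)) \<beta>
      = (\<lambda>L. (- 1) ^ length fs * wedge (wedge (differential f) \<beta>) (wedge_differentials fs) L)"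
    unfolding wedge_differentials_simps wedge_assoc Cons.IH wedge_scale_right ..
  also have "\<dots> = (\<lambda>L. (- 1) ^ length (f # fs) * wedge \<beta> (wedge_differentials (f # fs)) L)"
    unfolding wedge_anticommute[OF assms is_1form_differential] wedge_scale_left
      wedge_differentials_simps wedge_assoc by (simp add: algebra_simps)
  finally show ?case .
qed

text \<open>
  This is what makes the differentials of all elements of k[f_1, ..., f_r] wedge to zero with
  df_1 \<and> ... \<and> df_r. The repeated factor is moved next to its copy.
\<close>

lemma wedge_differentials_repeated:
  fixes fs :: "('n::{finite,linorder}, 'k::field_char_0) mpol list"
  assumes "f \<in> set fs"
  shows "wedge (wedge_differentials fs) (differential f) = (\<lambda>_. 0)"
  using assms
proof (induction fs)
  case (Cons h fs)
  show ?case
  proof (cases "f = h")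
    case True
    have "wedge (differential f) (wedge (differential f) (wedge_differentials fs)) = (\<lambda>_. 0)"
      unfolding wedge_assoc[symmetric] wedge_1form_self[OF is_1form_differential] by (rule wedge_0_left)
    then show ?thesis
      unfolding wedge_differentials_simps wedge_assoc True
        wedge_differentials_commute[OF is_1form_differential] wedge_scale_right by simp
  next
    case False
    then show ?thesis
      using Cons by (simp add: wedge_differentials_simps wedge_assoc wedge_0_right)
  qed
qed simp

text \<open>
  The interior product with the vector field v. By \<open>contract_wedge_1form\<close> it is an antiderivation
  for wedge products with a one-form on the left, which allows the nonvanishing of a wedge product to
  be detected factor by factor.
\<close>

definition contract ::
  "('n::{finite,linorder} \<Rightarrow> ('n, 'k::comm_ring_1) mpol) \<Rightarrow> ('n, 'k) form \<Rightarrow> ('n, 'k) form"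
  where "contract v \<eta> = (\<lambda>L. \<Sum>i\<in>- L. inv_sign {i} L * v i * \<eta> (insert i L))"

lemma wedge_1form_eq:
  assumes "is_1form \<alpha>"
  shows "wedge \<alpha> \<eta> L = (\<Sum>l\<in>L. inv_sign {l} (L - {l}) * \<alpha> {l} * \<eta> (L - {l}))"
proof -
  have "wedge \<alpha> \<eta> L = (\<Sum>I\<in>(\<lambda>l. {l}) ` L. inv_sign I (L - I) * \<alpha> I * \<eta> (L - I))"
    unfolding wedge_eq
  proof (rule sum.mono_neutral_right)
    show "\<forall>I\<in>Pow L - (\<lambda>l. {l}) ` L. inv_sign I (L - I) * \<alpha> I * \<eta> (L - I) = 0"
    proof
      fix I assume I: "I \<in> Pow L - (\<lambda>l. {l}) ` L"
      have "card I \<noteq> 1"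
      proof
        assume "card I = 1"
        then obtain l where "I = {l}" by (rule card_1_singletonE)
        then show False using I by auto
      qed
      then show "inv_sign I (L - I) * \<alpha> I * \<eta> (L - I) = 0"
        using assms by (simp add: is_1form_def)
    qed
  qed auto
  also have "\<dots> = (\<Sum>l\<in>L. inv_sign {l} (L - {l}) * \<alpha> {l} * \<eta> (L - {l}))"
    by (subst sum.reindex) (auto simp: inj_on_def)
  finally show ?thesis .
qed

text \<open>
  On the left the sum runs over pairs of an index i inserted by the contraction and an index l
  removed by \<alpha>. The terms with i = l, together with those in which i is inserted where \<alpha> has
  just removed it, make up the pairing of \<alpha> and v. In the terms with i \<noteq> l, exchanging the two
  operations costs one transposition, hence the sign.
\<close>

lemma contract_wedge_1form:
  assumes \<alpha>: "is_1form \<alpha>"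
  shows "contract v (wedge \<alpha> \<eta>) L
    = (\<Sum>i\<in>UNIV. \<alpha> {i} * v i) * \<eta> L - wedge \<alpha> (contract v \<eta>) L"
proof -
  let ?t = "\<lambda>i l. inv_sign {l} (L - {l}) * inv_sign {i} (L - {l}) * \<alpha> {l} * v i * \<eta> (insert i (L - {l}))"
  have 1: "inv_sign {i} L * v i * wedge \<alpha> \<eta> (insert i L) = \<alpha> {i} * v i * \<eta> L - (\<Sum>l\<in>L. ?t i l)"
    if "i \<notin> L" for i
  proof -
    have "wedge \<alpha> \<eta> (insert i L) = inv_sign {i} L * \<alpha> {i} * \<eta> L
       + (\<Sum>l\<in>L. inv_sign {l} (insert i L - {l}) * \<alpha> {l} * \<eta> (insert i L - {l}))"
      unfolding wedge_1form_eq[OF \<alpha>] using that by simp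
    moreover have "inv_sign {i} L * v i * (inv_sign {l} (insert i L - {l}) * \<alpha> {l} * \<eta> (insert i L - {l})) = - ?t i l"
      if l: "l \<in> L" for l
    proof -
      have ne: "i \<noteq> l" using l \<open>i \<notin> L\<close> by auto
      then have e: "insert i L - {l} = insert i (L - {l})" by auto
      have s1: "inv_sign {l} (insert i (L - {l})) = inv_sign {l} {i} * (inv_sign {l} (L - {l}) :: ('a, 'b) mpol)"
        using inv_sign_Un_right[of "{i}" "L - {l}" "{l}"] \<open>i \<notin> L\<close> by simp
      have s2: "inv_sign {i} L = inv_sign {i} {l} * (inv_sign {i} (L - {l}) :: ('a, 'b) mpol)"
        using inv_sign_Un_right[of "{l}" "L - {l}" "{i}"] l by (simp add: insert_absorb)
      have "inv_sign {i} L * v i * (inv_sign {l} (insert i L - {l}) * \<alpha> {l} * \<eta> (insert i L - {l}))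
        = (inv_sign {i} {l} * inv_sign {l} {i}) * ?t i l"
        unfolding e s1 s2 by (simp add: ac_simps)
      then show ?thesis by (simp add: inv_sign_singletons[OF ne])
    qed
    moreover have "inv_sign {i} L * v i * (inv_sign {i} L * \<alpha> {i} * \<eta> L) = \<alpha> {i} * v i * \<eta> L"
      using inv_sign_square[of "{i}" L, where ?'a = "('a, 'b) mpol"]
      by (metis (no_types, lifting) mult.assoc mult.commute mult_1_left)
    ultimately show ?thesis
      by (simp add: distrib_left sum_distrib_left sum_negf)
  qed
  have 2: "inv_sign {l} (L - {l}) * \<alpha> {l} * contract v \<eta> (L - {l}) = \<alpha> {l} * v l * \<eta> L + (\<Sum>i\<in>- L. ?t i l)"
    if l: "l \<in> L" for l
  proof -
    have "- (L - {l}) = insert l (- L)" "insert l (L - {l}) = L" using l by auto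
    then have "contract v \<eta> (L - {l}) = inv_sign {l} (L - {l}) * v l * \<eta> L
        + (\<Sum>i\<in>- L. inv_sign {i} (L - {l}) * v i * \<eta> (insert i (L - {l})))"
      using l by (simp add: contract_def)
    moreover have "inv_sign {l} (L - {l}) * \<alpha> {l} * (inv_sign {l} (L - {l}) * v l * \<eta> L) = \<alpha> {l} * v l * \<eta> L"
      using inv_sign_square[of "{l}" "L - {l}", where ?'a = "('a, 'b) mpol"]
      by (metis (no_types, lifting) mult.assoc mult.commute mult_1_left)
    ultimately show ?thesis
      by (simp add: distrib_left sum_distrib_left ac_simps)
  qed
  have "contract v (wedge \<alpha> \<eta>) L = (\<Sum>i\<in>- L. \<alpha> {i} * v i * \<eta> L) - (\<Sum>i\<in>- L. \<Sum>l\<in>L. ?t i l)"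
    by (simp add: contract_def 1 sum_subtractf)
  moreover have "wedge \<alpha> (contract v \<eta>) L = (\<Sum>l\<in>L. \<alpha> {l} * v l * \<eta> L) + (\<Sum>l\<in>L. \<Sum>i\<in>- L. ?t i l)"
    by (simp add: wedge_1form_eq[OF \<alpha>] 2 sum.distrib)
  moreover have "(\<Sum>l\<in>L. \<Sum>i\<in>- L. ?t i l) = (\<Sum>i\<in>- L. \<Sum>l\<in>L. ?t i l)"
    by (rule sum.swap)
  moreover have "(\<Sum>i\<in>UNIV. \<alpha> {i} * v i) * \<eta> L = (\<Sum>l\<in>L. \<alpha> {l} * v l * \<eta> L) + (\<Sum>i\<in>- L. \<alpha> {i} * v i * \<eta> L)"
    unfolding sum_distrib_right Compl_eq_Diff_UNIV
    by (subst sum.subset_diff[of L UNIV]) (simp_all add: add.commute)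
  ultimately show ?thesis by simp
qed

lemma wedge_differentials_contract_0:
  assumes "\<forall>f\<in>set fs. (\<Sum>i\<in>UNIV. pdiff i f * v i) = 0"
  shows "contract v (wedge_differentials fs) = (\<lambda>_. 0)"
  using assms
proof (induction fs)
  case Nil
  then show ?case by (simp add: wedge_differentials_simps contract_def one_form_def)
next
  case (Cons f fs)
  then show ?case
    by (auto simp: wedge_differentials_simps contract_wedge_1form[OF is_1form_differential]
        differential_singleton wedge_0_right)
qed

text \<open>
  Contracting with the vector dual to the first factor removes that factor up to a nonzero
  polynomial: the other term of the antiderivation rule is zero because this vector is orthogonal
  to all remaining factors. Then induct.
\<close>

lemma wedge_differentials_nonzero:
  fixes fs :: "('n::{finite,linorder}, 'k::idom) mpol list"
  assumes "\<And>j. j < length fs \<Longrightarrow> \<exists>v. (\<Sum>i\<in>UNIV. pdiff i (fs ! j) * v i) \<noteq> 0 \<and>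
     (\<forall>l<length fs. l \<noteq> j \<longrightarrow> (\<Sum>i\<in>UNIV. pdiff i (fs ! l) * v i) = 0)"
  shows "\<exists>L. wedge_differentials fs L \<noteq> 0"
  using assms
proof (induction fs)
  case Nil
  have "wedge_differentials [] {} = (1 :: ('n, 'k) mpol)"
    by (simp add: wedge_differentials_simps one_form_def)
  then show ?case by (metis zero_neq_one)
next
  case (Cons f fs)
  have "\<exists>L. wedge_differentials fs L \<noteq> 0"
  proof (rule Cons.IH)
    fix j assume "j < length fs"
    with Cons.prems[of "Suc j"] show "\<exists>v. (\<Sum>i\<in>UNIV. pdiff i (fs ! j) * v i) \<noteq> 0 \<and>
       (\<forall>l<length fs. l \<noteq> j \<longrightarrow> (\<Sum>i\<in>UNIV. pdiff i (fs ! l) * v i) = 0)" by fastforce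
  qed
  then obtain L where L: "wedge_differentials fs L \<noteq> 0" by blast
  obtain v where v: "(\<Sum>i\<in>UNIV. pdiff i f * v i) \<noteq> 0"
     "\<forall>l<length (f # fs). l \<noteq> 0 \<longrightarrow> (\<Sum>i\<in>UNIV. pdiff i ((f # fs) ! l) * v i) = 0"
    using Cons.prems[of 0] by auto
  have "\<forall>h\<in>set fs. (\<Sum>i\<in>UNIV. pdiff i h * v i) = 0"
    using v(2) by (fastforce simp: in_set_conv_nth)
  from wedge_differentials_contract_0[OF this]
  have "contract v (wedge_differentials (f # fs)) L = (\<Sum>i\<in>UNIV. pdiff i f * v i) * wedge_differentials fs L"
    by (simp add: wedge_differentials_simps contract_wedge_1form[OF is_1form_differential]
        differential_singleton wedge_0_right)
  then have "contract v (wedge_differentials (f # fs)) L \<noteq> 0"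
    using v(1) L by simp
  moreover have "contract v (\<lambda>_. 0) = (\<lambda>_. 0)" by (simp add: contract_def)
  ultimately show ?case by (metis ext)
qed

section \<open>Differentials\<close>

lemma poly_mapping_monomial_induct [case_names monom add]:
  fixes f :: "'a \<Rightarrow>\<^sub>0 'b::comm_monoid_add"
  assumes monom: "\<And>m c. P (Poly_Mapping.single m c)" and add: "\<And>f h. P f \<Longrightarrow> P h \<Longrightarrow> P (f + h)"
  shows "P f"
proof -
  have "P (\<Sum>m\<in>S. Poly_Mapping.single m (Poly_Mapping.lookup f m))" if "finite S" for S
    using that
  proof induction
    case empty
    show ?case using monom[of undefined 0] by simp
  qed (auto intro: monom add)
  moreover have "(\<Sum>m\<in>Poly_Mapping.keys f. Poly_Mapping.single m (Poly_Mapping.lookup f m)) = f"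
    by (rule poly_mapping_eqI) (simp add: lookup_sum lookup_single when_def in_keys_iff)
  ultimately show ?thesis by (metis finite_keys)
qed

lemma minus_single_eq_iff:
  "m' - Poly_Mapping.single i 1 = m \<and> Poly_Mapping.lookup m' i \<noteq> 0
    \<longleftrightarrow> m' = (m :: 'n \<Rightarrow>\<^sub>0 nat) + Poly_Mapping.single i 1"
proof
  assume "m' - Poly_Mapping.single i 1 = m \<and> Poly_Mapping.lookup m' i \<noteq> 0"
  then show "m' = m + Poly_Mapping.single i 1"
    by (auto intro!: poly_mapping_eqI simp: lookup_add lookup_minus lookup_single when_def)
qed (auto simp: lookup_add)

lemma lookup_pdiff:
  "Poly_Mapping.lookup (pdiff i f) m
    = of_nat (Suc (Poly_Mapping.lookup m i)) * Poly_Mapping.lookup f (m + Poly_Mapping.single i 1)"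
proof -
  let ?m = "m + Poly_Mapping.single i 1"
  have "Poly_Mapping.lookup (pdiff i f) m = (\<Sum>m'\<in>Poly_Mapping.keys f.
      if m' = ?m then of_nat (Poly_Mapping.lookup m' i) * Poly_Mapping.lookup f m' else 0)"
    unfolding pdiff_def lookup_sum
  proof (rule sum.cong)
    fix m'
    show "Poly_Mapping.lookup (Poly_Mapping.single (m' - Poly_Mapping.single i 1)
        (of_nat (Poly_Mapping.lookup m' i) * Poly_Mapping.lookup f m')) m
      = (if m' = ?m then of_nat (Poly_Mapping.lookup m' i) * Poly_Mapping.lookup f m' else 0)"
      using minus_single_eq_iff[of m' i m]
      by (cases "Poly_Mapping.lookup m' i = 0") (auto simp: lookup_single when_def)
  qed simp
  then show ?thesis by (simp add: in_keys_iff lookup_add)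
qed

lemma pdiff_add: "pdiff i (f + h) = pdiff i f + pdiff i h"
  by (rule poly_mapping_eqI) (simp add: lookup_pdiff lookup_add distrib_left)

lemma pdiff_single: "pdiff i (Poly_Mapping.single m c)
   = Poly_Mapping.single (m - Poly_Mapping.single i 1) (of_nat (Poly_Mapping.lookup m i) * c)"
  by (simp add: pdiff_def)

lemma pdiff_scalar [simp]: "pdiff i (scalar c) = 0"
  by (simp add: scalar_def pdiff_single)

lemma pdiff_mult:
  fixes f h :: "('n, 'k::comm_ring_1) mpol"
  shows "pdiff i (f * h) = f * pdiff i h + h * pdiff i f"
proof (induction f rule: poly_mapping_monomial_induct)
  case (monom m c)
  show ?case
  proof (induction h rule: poly_mapping_monomial_induct)
    case (monom m' c')
    let ?e = "Poly_Mapping.single i (1::nat)"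
    have 1: "of_nat (Poly_Mapping.lookup p i) \<noteq> (0::'k) \<Longrightarrow> q + (p - ?e) = q + p - ?e" for p q :: "'n \<Rightarrow>\<^sub>0 nat"
    proof -
      assume "of_nat (Poly_Mapping.lookup p i) \<noteq> (0::'k)"
      then have "Poly_Mapping.lookup p i \<noteq> 0" by (metis of_nat_0)
      then show ?thesis
        by (intro poly_mapping_eqI) (auto simp: lookup_add lookup_minus lookup_single when_def)
    qed
    have 2: "Poly_Mapping.single (q + (p - ?e)) (x * (of_nat (Poly_Mapping.lookup p i) * y))
        = Poly_Mapping.single (q + p - ?e) (of_nat (Poly_Mapping.lookup p i) * (x * y))"
      for p q :: "'n \<Rightarrow>\<^sub>0 nat" and x y :: 'k
    proof (cases "of_nat (Poly_Mapping.lookup p i) = (0::'k)")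
      case False
      show ?thesis unfolding 1[OF False] by (simp only: ac_simps)
    qed simp
    show ?case
      unfolding pdiff_single mult_single 2 lookup_add of_nat_add distrib_right single_add
      by (simp only: ac_simps)
  qed (simp add: pdiff_add algebra_simps)
qed (simp add: pdiff_add algebra_simps)

lemma differential_add: "differential (f + h) = (\<lambda>I. differential f I + differential h I)"
  by (simp add: differential_def pdiff_add sum.distrib)

lemma differential_mult: "differential (f * h) = (\<lambda>I. f * differential h I + h * differential f I)"
  by (simp add: differential_def pdiff_mult sum.distrib sum_distrib_left)

lemma differential_scalar: "differential (scalar c) = (\<lambda>_. 0)"
  by (simp add: differential_def)

lemma wedge_differential_subalg:
  fixes fs :: "('n::{finite,linorder}, 'k::field_char_0) mpol list"
  assumes "h \<in> subalg (set fs)"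
  shows "wedge (wedge_differentials fs) (differential h) = (\<lambda>_. 0)"
  using assms
  by induction (simp_all add: differential_scalar differential_add differential_mult wedge_0_right
      wedge_add_right wedge_scale_right wedge_differentials_repeated)

text \<open>
  The chain rule d(\<Phi>(g)) = \<Sum> d(\<phi>_i) g^i + \<Phi>'(g) dg; the hypothesis makes \<omega> kill the first sum.
\<close>

lemma wedge_differential_poly:
  fixes \<omega> :: "('n::{finite,linorder}, 'k::field_char_0) form"
  assumes "\<And>i. wedge \<omega> (differential (Polynomial.coeff \<Phi> i)) = (\<lambda>_. 0)"
  shows "wedge \<omega> (differential (poly \<Phi> g)) = (\<lambda>L. poly (pderiv \<Phi>) g * wedge \<omega> (differential g) L)"
  using assms
proof (induction \<Phi>)
  case 0
  have "differential (0 :: ('n, 'k) mpol) = (\<lambda>_. 0)" using differential_scalar[of 0] by (simp add: scalar_def)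
  then show ?case by (simp add: wedge_0_right)
next
  case (pCons a \<Phi>)
  have "wedge \<omega> (differential a) = (\<lambda>_. 0)" using pCons.prems[of 0] by simp
  moreover have "wedge \<omega> (differential (poly \<Phi> g)) = (\<lambda>L. poly (pderiv \<Phi>) g * wedge \<omega> (differential g) L)"
    using pCons.prems[of "Suc i" for i] by (intro pCons.IH) simp
  ultimately show ?case
    by (simp add: differential_add differential_mult wedge_add_right wedge_scale_right pderiv_pCons)
      (simp add: fun_eq_iff algebra_simps)
qed

section \<open>Degrees of forms\<close>

lemma form_wdeg_le_iff: "form_wdeg w \<eta> \<le> x \<longleftrightarrow> (\<forall>I. wdeg w (\<eta> I) + Fin (sum w I) \<le> x)"
  unfolding form_wdeg_def by (subst Max_le_iff) auto

lemma form_wdeg_ge: "wdeg w (\<eta> I) + Fin (sum w I) \<le> form_wdeg w \<eta>"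
  using form_wdeg_le_iff by blast

lemma form_wdeg_neq_Pinf: "form_wdeg w \<eta> \<noteq> Pinf"
proof -
  have "form_wdeg w \<eta> \<in> range (\<lambda>I. wdeg w (\<eta> I) + Fin (sum w I))"
    unfolding form_wdeg_def by (rule Max_in) auto
  then obtain I where I: "form_wdeg w \<eta> = wdeg w (\<eta> I) + Fin (sum w I)" by blast
  show ?thesis unfolding I by (cases "wdeg w (\<eta> I)") auto
qed

lemma form_wdeg_nonzeroE:
  assumes "\<eta> L \<noteq> 0"
  obtains \<gamma> where "form_wdeg w \<eta> = Fin \<gamma>"
proof (cases "form_wdeg w \<eta>")
  case Minf
  then have "wdeg w (\<eta> L) + Fin (sum w L) = Minf" using form_wdeg_ge[of w \<eta> L] by simp
  then have "wdeg w (\<eta> L) = Minf" by (cases "wdeg w (\<eta> L)") auto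
  then show ?thesis using assms by simp
qed (use form_wdeg_neq_Pinf that in auto)

lemma wdeg_sum_plus_le:
  fixes x :: "'v::linordered_ab_group_add extended"
  assumes "\<And>i. i \<in> I \<Longrightarrow> wdeg w (f i) + Fin d \<le> x"
  shows "wdeg w (sum f I) + Fin d \<le> x"
proof (cases x)
  case (Fin \<mu>)
  show ?thesis
    using assms unfolding Fin extended_plus_le_Fin_iff by (rule wdeg_sum_le)
next
  case Minf
  have *: "y + Fin d = Minf \<longleftrightarrow> y = Minf" for y :: "'v extended" by (cases y) auto
  show ?thesis using assms unfolding Minf le_Minf * by simp
qed simp

text \<open>
  The weight of dx_L is the sum of those of dx_I and dx_(L - I), so every summand of a coefficient
  of the product obeys the bound.
\<close>

lemma form_wdeg_wedge_le:
  fixes \<eta> \<theta> :: "('n::{finite,linorder}, 'k::idom) form"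
  shows "form_wdeg w (wedge \<eta> \<theta>) \<le> form_wdeg w \<eta> + form_wdeg w \<theta>"
  unfolding form_wdeg_le_iff wedge_eq
proof (intro allI wdeg_sum_plus_le)
  fix L I :: "'n set" assume I: "I \<in> Pow L"
  have "wdeg w (inv_sign I (L - I) * \<eta> I * \<theta> (L - I)) = wdeg w (\<eta> I) + wdeg w (\<theta> (L - I))"
    using inv_sign_cases[of I "L - I", where ?'a = "('n, 'k) mpol"] by (auto simp: wdeg_mult simp flip: zero_extended_def)
  moreover have "Fin (sum w L) = Fin (sum w I) + Fin (sum w (L - I))"
    using I by (simp add: sum.subset_diff[of I L] add.commute)
  ultimately have "wdeg w (inv_sign I (L - I) * \<eta> I * \<theta> (L - I)) + Fin (sum w L)
      = (wdeg w (\<eta> I) + Fin (sum w I)) + (wdeg w (\<theta> (L - I)) + Fin (sum w (L - I)))"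
    by (simp only: ac_simps)
  also have "\<dots> \<le> form_wdeg w \<eta> + form_wdeg w \<theta>"
    by (intro add_mono form_wdeg_ge)
  finally show "wdeg w (inv_sign I (L - I) * \<eta> I * \<theta> (L - I)) + Fin (sum w L)
      \<le> form_wdeg w \<eta> + form_wdeg w \<theta>" .
qed

lemma form_wdeg_scale:
  fixes \<eta> :: "('n::{finite,linorder}, 'k::idom) form"
  shows "form_wdeg w (\<lambda>L. c * \<eta> L) = wdeg w c + form_wdeg w \<eta>"
proof -
  have "wdeg w c + form_wdeg w \<eta> = Max ((+) (wdeg w c) ` range (\<lambda>I. wdeg w (\<eta> I) + Fin (sum w I)))"
    unfolding form_wdeg_def by (rule mono_Max_commute) (auto intro: monoI add_left_mono)
  also have "(+) (wdeg w c) ` range (\<lambda>I. wdeg w (\<eta> I) + Fin (sum w I))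
      = range (\<lambda>I. wdeg w (c * \<eta> I) + Fin (sum w I))"
    by (simp add: image_image wdeg_mult add.assoc)
  finally show ?thesis by (simp add: form_wdeg_def)
qed

text \<open>
  The weight w_i that dx_i contributes compensates exactly for the factor x_i that differentiation
  removes.
\<close>

lemma wdeg_pdiff_le: "wdeg w (pdiff i f) + Fin (w i) \<le> wdeg w f"
proof (cases "f = 0")
  case True
  then show ?thesis by (simp add: pdiff_def)
next
  case False
  then obtain \<gamma> where \<gamma>: "wdeg w f = Fin \<gamma>" by (rule wdeg_nonzeroE)
  have "weight w m \<le> \<gamma> - w i" if "m \<in> Poly_Mapping.keys (pdiff i f)" for m
  proof -
    have "m + Poly_Mapping.single i 1 \<in> Poly_Mapping.keys f"
      using that by (auto simp: in_keys_iff lookup_pdiff)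
    then have "weight w (m + Poly_Mapping.single i 1) \<le> \<gamma>"
      using \<gamma> wdeg_le_iff[of w f \<gamma>] by simp
    then show ?thesis unfolding weight_add weight_single by (simp add: algebra_simps)
  qed
  then show ?thesis unfolding \<gamma> extended_plus_le_Fin_iff wdeg_le_iff by blast
qed

lemma form_wdeg_differential_le: "form_wdeg w (differential f) \<le> wdeg w f"
  unfolding form_wdeg_le_iff
proof
  fix I
  show "wdeg w (differential f I) + Fin (sum w I) \<le> wdeg w f"
  proof (cases "card I = 1")
    case True
    then obtain i where "I = {i}" by (rule card_1_singletonE)
    then show ?thesis by (simp add: differential_singleton wdeg_pdiff_le)
  next
    case False
    then have "differential f I = 0" using is_1form_differential[of f] by (auto simp: is_1form_def)
    then show ?thesis by simp
  qed
qed

section \<open>Polynomials over subrings\<close>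

definition is_subring :: "'a::comm_ring_1 set \<Rightarrow> bool"
  where "is_subring R \<longleftrightarrow> 1 \<in> R \<and> (\<forall>a\<in>R. - a \<in> R) \<and> (\<forall>a\<in>R. \<forall>b\<in>R. a + b \<in> R \<and> a * b \<in> R)"

lemma is_subringD:
  assumes "is_subring R"
  shows "1 \<in> R" "0 \<in> R" "a \<in> R \<Longrightarrow> - a \<in> R" "a \<in> R \<Longrightarrow> b \<in> R \<Longrightarrow> a + b \<in> R"
    "a \<in> R \<Longrightarrow> b \<in> R \<Longrightarrow> a * b \<in> R" "a \<in> R \<Longrightarrow> b \<in> R \<Longrightarrow> a - b \<in> R"
proof -
  show *: "1 \<in> R" "a \<in> R \<Longrightarrow> - a \<in> R" "a \<in> R \<Longrightarrow> b \<in> R \<Longrightarrow> a + b \<in> R"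
    "a \<in> R \<Longrightarrow> b \<in> R \<Longrightarrow> a * b \<in> R" for a b
    using assms by (auto simp: is_subring_def)
  show "0 \<in> R" using *(3)[OF *(1) *(2)[OF *(1)]] by simp
  show "a \<in> R \<Longrightarrow> b \<in> R \<Longrightarrow> a - b \<in> R"
    using *(3)[of a "- b"] *(2)[of b] by simp
qed

lemma is_subring_sum: "is_subring R \<Longrightarrow> (\<And>i. i \<in> I \<Longrightarrow> f i \<in> R) \<Longrightarrow> sum f I \<in> R"
  by (induction I rule: infinite_finite_induct) (auto intro: is_subringD)

lemma is_subring_of_nat: "is_subring R \<Longrightarrow> of_nat n \<in> R"
  by (induction n) (auto intro: is_subringD)

lemma polys_over_coeff: "p \<in> polys_over R \<Longrightarrow> Polynomial.coeff p i \<in> R"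
  by (simp add: polys_over_def)

lemma polys_over_closed:
  assumes R: "is_subring R"
  shows "c \<in> R \<Longrightarrow> [:c:] \<in> polys_over R"
    and "0 \<in> polys_over R"
    and "p \<in> polys_over R \<Longrightarrow> q \<in> polys_over R \<Longrightarrow> p + q \<in> polys_over R"
    and "p \<in> polys_over R \<Longrightarrow> q \<in> polys_over R \<Longrightarrow> p * q \<in> polys_over R"
    and "p \<in> polys_over R \<Longrightarrow> q \<in> polys_over R \<Longrightarrow> p - q \<in> polys_over R"
    and "p \<in> polys_over R \<Longrightarrow> c \<in> R \<Longrightarrow> Polynomial.smult c p \<in> polys_over R"
    and "c \<in> R \<Longrightarrow> Polynomial.monom c n \<in> polys_over R"
    and "p \<in> polys_over R \<Longrightarrow> pderiv p \<in> polys_over R"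
  using is_subringD[OF R] is_subring_sum[OF R] is_subring_of_nat[OF R]
  by (auto simp: polys_over_def coeff_pCons coeff_mult coeff_pderiv simp del: of_nat_Suc split: nat.split
      intro!: is_subring_sum[OF R])

text \<open>
  Division with remainder without inverting leading coefficients: working up to a nonzero constant
  of the subring replaces passing to its field of fractions.
\<close>

lemma pseudo_division:
  fixes q :: "'a::idom poly"
  assumes R: "is_subring R" and q: "q \<in> polys_over R" "q \<noteq> 0" and p: "p \<in> polys_over R"
  shows "\<exists>c\<in>R. \<exists>s\<in>polys_over R. \<exists>r\<in>polys_over R. c \<noteq> 0 \<and> Polynomial.smult c p = q * s + r
    \<and> (r = 0 \<or> Polynomial.degree r < Polynomial.degree q)"
proof -
  have "p \<in> polys_over R \<Longrightarrow> p = 0 \<or> Polynomial.degree p < n \<Longrightarrow> ?thesis" for n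
  proof (induction n arbitrary: p)
    case 0
    then show ?case
      using is_subringD[OF R] polys_over_closed[OF R] by (intro bexI[of _ 1] bexI[of _ 0]) auto
  next
    case (Suc n)
    show ?case
    proof (cases "p = 0 \<or> Polynomial.degree p < Polynomial.degree q")
      case True
      then show ?thesis
        using is_subringD[OF R] polys_over_closed[OF R] Suc.prems
        by (intro bexI[of _ 1] bexI[of _ 0] bexI[of _ p]) auto
    next
      case False
      then have deg: "Polynomial.degree q \<le> Polynomial.degree p" by simp
      define u where "u = Polynomial.monom (lead_coeff p) (Polynomial.degree p - Polynomial.degree q)"
      define p' where "p' = Polynomial.smult (lead_coeff q) p - q * u"
      have lc: "lead_coeff p \<in> R" "lead_coeff q \<in> R"
        using q Suc.prems by (auto intro: polys_over_coeff)
      have u: "u \<in> polys_over R" unfolding u_def by (rule polys_over_closed(7)[OF R lc(1)])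
      then have p': "p' \<in> polys_over R"
        unfolding p'_def using q Suc.prems lc polys_over_closed[OF R] by auto
      have "Polynomial.degree (q * u) \<le> Polynomial.degree p"
        unfolding u_def using deg degree_mult_le[of q] degree_monom_le
        by (metis (no_types, opaque_lifting) add_le_cancel_left le_add_diff_inverse le_trans)
      then have "Polynomial.degree p' \<le> Polynomial.degree p"
        unfolding p'_def by (intro degree_diff_le) (auto intro: order_trans[OF degree_smult_le])
      moreover have "Polynomial.coeff (q * u) (Polynomial.degree p) = lead_coeff q * lead_coeff p"
        unfolding u_def mult.commute[of q] coeff_monom_mult using deg by (simp add: mult.commute)
      then have "Polynomial.coeff p' (Polynomial.degree p) = 0"
        by (simp add: p'_def)
      ultimately have "p' = 0 \<or> Polynomial.degree p' < Polynomial.degree p"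
        by (rule eq_zero_or_degree_less)
      then have "p' = 0 \<or> Polynomial.degree p' < n" using Suc.prems(2) False by auto
      from Suc.IH[OF p' this] obtain c s r where IH: "c \<in> R" "s \<in> polys_over R" "r \<in> polys_over R" "c \<noteq> 0"
        "Polynomial.smult c p' = q * s + r" "r = 0 \<or> Polynomial.degree r < Polynomial.degree q" by blast
      have "Polynomial.smult (c * lead_coeff q) p = q * (s + Polynomial.smult c u) + r"
        using IH(5) unfolding p'_def by (simp add: algebra_simps smult_diff_right)
      moreover have "c * lead_coeff q \<in> R" "s + Polynomial.smult c u \<in> polys_over R" "c * lead_coeff q \<noteq> 0"
        using IH lc u q is_subringD[OF R] polys_over_closed[OF R] by auto
      ultimately show ?thesis using IH by blast
    qed
  qed
  from this[of "Suc (Polynomial.degree p)"] p show ?thesis by simp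
qed

text \<open>
  Up to a constant factor, this is the minimal polynomial of x over the field of fractions of R.
\<close>

definition minimal_vanishing :: "'a::comm_ring_1 set \<Rightarrow> 'a \<Rightarrow> 'a poly \<Rightarrow> bool"
  where "minimal_vanishing R x q \<longleftrightarrow> q \<in> polys_over R \<and> q \<noteq> 0 \<and> poly q x = 0 \<and>
    (\<forall>p\<in>polys_over R. p \<noteq> 0 \<longrightarrow> poly p x = 0 \<longrightarrow> Polynomial.degree q \<le> Polynomial.degree p)"

lemma minimal_vanishing_exists:
  assumes "p \<in> polys_over R" "p \<noteq> 0" "poly p x = 0"
  obtains q where "minimal_vanishing R x q"
proof -
  let ?P = "\<lambda>q. q \<in> polys_over R \<and> q \<noteq> 0 \<and> poly q x = 0"
  have "?P p" using assms by simp
  from ex_has_least_nat[of ?P, OF this, of Polynomial.degree] that show ?thesis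
    by (auto simp: minimal_vanishing_def)
qed

lemma minimal_vanishing_dvd:
  fixes x :: "'a::idom"
  assumes R: "is_subring R" and q: "minimal_vanishing R x q" and p: "p \<in> polys_over R" "poly p x = 0"
  obtains c s where "c \<in> R" "c \<noteq> 0" "s \<in> polys_over R" "Polynomial.smult c p = q * s"
proof -
  have "q \<in> polys_over R" "q \<noteq> 0" using q by (auto simp: minimal_vanishing_def)
  from pseudo_division[OF R this p(1)]
  obtain c s r where *: "c \<in> R" "s \<in> polys_over R" "r \<in> polys_over R" "c \<noteq> 0"
    "Polynomial.smult c p = q * s + r" "r = 0 \<or> Polynomial.degree r < Polynomial.degree q"
    by blast
  have "poly (Polynomial.smult c p) x = 0" using p by simp
  then have "poly r x = 0" unfolding *(5) using q by (simp add: minimal_vanishing_def)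
  then have "r = 0" using *(3,6) q by (fastforce simp: minimal_vanishing_def)
  then show ?thesis using * that by simp
qed

text \<open>
  Separability in characteristic zero: the derivative is a nonzero polynomial of smaller degree, so
  by minimality it cannot vanish at x.
\<close>

lemma minimal_vanishing_pderiv:
  fixes x :: "'a::{idom,ring_char_0}"
  assumes R: "is_subring R" and q: "minimal_vanishing R x q"
  shows "poly (pderiv q) x \<noteq> 0"
proof
  assume 0: "poly (pderiv q) x = 0"
  have d: "Polynomial.degree q \<noteq> 0"
  proof
    assume "Polynomial.degree q = 0"
    then obtain c where "q = [:c:]" by (rule degree_eq_zeroE)
    then show False using q by (simp add: minimal_vanishing_def)
  qed
  then have "pderiv q \<noteq> 0" by (simp add: pderiv_eq_0_iff)
  then have "Polynomial.degree q \<le> Polynomial.degree (pderiv q)"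
    using q 0 polys_over_closed(8)[OF R, of q] by (auto simp: minimal_vanishing_def)
  then show False using d by (simp add: degree_pderiv)
qed

section \<open>Extension of derivations\<close>

definition derivation_on :: "'a::comm_ring_1 set \<Rightarrow> ('a \<Rightarrow> 'a) \<Rightarrow> bool"
  where "derivation_on R D \<longleftrightarrow> (\<forall>a\<in>R. \<forall>b\<in>R. D (a + b) = D a + D b \<and> D (a * b) = a * D b + b * D a)"

definition adjoin :: "'a::comm_ring_1 set \<Rightarrow> 'a \<Rightarrow> 'a set"
  where "adjoin R x = (\<lambda>p. poly p x) ` polys_over R"

lemma adjoin_subring:
  fixes R :: "'a::idom set"
  assumes R: "is_subring R"
  shows "is_subring (adjoin R x)" "R \<subseteq> adjoin R x" "x \<in> adjoin R x"
proof -
  show "R \<subseteq> adjoin R x"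
  proof
    fix a assume "a \<in> R"
    then show "a \<in> adjoin R x"
      unfolding adjoin_def by (intro image_eqI[of _ _ "[:a:]"] polys_over_closed(1)[OF R]) auto
  qed
  have "Polynomial.monom 1 1 \<in> polys_over R"
    by (intro polys_over_closed(7)[OF R] is_subringD[OF R])
  then show "x \<in> adjoin R x"
    unfolding adjoin_def by (rule image_eqI[rotated]) (simp add: poly_monom)
  have 1: "1 \<in> adjoin R x" using \<open>R \<subseteq> adjoin R x\<close> is_subringD(1)[OF R] by blast
  have neg: "- a \<in> adjoin R x" if a: "a \<in> adjoin R x" for a
  proof -
    obtain p where p: "p \<in> polys_over R" "a = poly p x" using a by (auto simp: adjoin_def)
    then have "- a = poly (0 - p) x" by simp
    then show ?thesis
      unfolding adjoin_def using polys_over_closed(5)[OF R polys_over_closed(2)[OF R] p(1)] by (rule image_eqI)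
  qed
  have "a + b \<in> adjoin R x \<and> a * b \<in> adjoin R x" if ab: "a \<in> adjoin R x" "b \<in> adjoin R x" for a b
  proof -
    obtain p q where pq: "p \<in> polys_over R" "a = poly p x" "q \<in> polys_over R" "b = poly q x"
      using ab by (auto simp: adjoin_def)
    then have "a + b = poly (p + q) x" "a * b = poly (p * q) x" by simp_all
    then show ?thesis
      unfolding adjoin_def using polys_over_closed(3,4)[OF R pq(1,3)] by (metis image_eqI)
  qed
  with 1 neg show "is_subring (adjoin R x)" by (auto simp: is_subring_def)
qed

context
  fixes R :: "'a::idom set" and D :: "'a \<Rightarrow> 'a"
  assumes R: "is_subring R" and D: "derivation_on R D"
begin

lemma derivation_add: "a \<in> R \<Longrightarrow> b \<in> R \<Longrightarrow> D (a + b) = D a + D b"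
  and derivation_mult: "a \<in> R \<Longrightarrow> b \<in> R \<Longrightarrow> D (a * b) = a * D b + b * D a"
  using D by (auto simp: derivation_on_def)

lemma derivation_0: "D 0 = 0"
  using derivation_add[OF is_subringD(2)[OF R] is_subringD(2)[OF R]]
  by (metis add_0_right add_left_cancel)

lemma derivation_sum: "(\<And>i. i \<in> I \<Longrightarrow> f i \<in> R) \<Longrightarrow> D (sum f I) = (\<Sum>i\<in>I. D (f i))"
proof (induction I rule: infinite_finite_induct)
  case (insert i I)
  then have "D (f i + sum f I) = D (f i) + D (sum f I)"
    by (intro derivation_add is_subring_sum[OF R]) auto
  then show ?case using insert by simp
qed (simp_all add: derivation_0)

lemma map_poly_derivation_mult:
  assumes "p \<in> polys_over R" "q \<in> polys_over R"
  shows "map_poly D (p * q) = p * map_poly D q + map_poly D p * q"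
proof (rule poly_eqI)
  fix n
  have "D (\<Sum>i\<le>n. Polynomial.coeff p i * Polynomial.coeff q (n - i))
     = (\<Sum>i\<le>n. D (Polynomial.coeff p i * Polynomial.coeff q (n - i)))"
    using assms by (intro derivation_sum is_subringD(5)[OF R] polys_over_coeff)
  also have "\<dots> = (\<Sum>i\<le>n. Polynomial.coeff p i * D (Polynomial.coeff q (n - i))
       + D (Polynomial.coeff p i) * Polynomial.coeff q (n - i))"
    using assms by (intro sum.cong refl) (simp add: derivation_mult polys_over_coeff mult.commute)
  finally show "Polynomial.coeff (map_poly D (p * q)) n
      = Polynomial.coeff (p * map_poly D q + map_poly D p * q) n"
    by (simp add: coeff_map_poly derivation_0 coeff_mult sum.distrib)
qed

lemma map_poly_derivation_add:
  assumes "p \<in> polys_over R" "q \<in> polys_over R"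
  shows "map_poly D (p + q) = map_poly D p + map_poly D q"
  by (rule poly_eqI) (simp add: coeff_map_poly derivation_0 derivation_add polys_over_coeff assms)

text \<open>
  If a derivation extends c D to R[x] and sends x to t, then the product and chain rules force this
  to be its value at p(x). The factor c clears denominators, so that all derivations take values in
  the ring itself and not in its field of fractions.
\<close>

definition lifted :: "'a \<Rightarrow> 'a \<Rightarrow> 'a \<Rightarrow> 'a poly \<Rightarrow> 'a"
  where "lifted x c t p = c * poly (map_poly D p) x + poly (pderiv p) x * t"

lemma lifted_add:
  "p \<in> polys_over R \<Longrightarrow> q \<in> polys_over R \<Longrightarrow> lifted x c t (p + q) = lifted x c t p + lifted x c t q"
  by (simp add: lifted_def map_poly_derivation_add pderiv_add algebra_simps)

lemma lifted_mult:
  "p \<in> polys_over R \<Longrightarrow> q \<in> polys_over R \<Longrightarrow>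
    lifted x c t (p * q) = poly p x * lifted x c t q + poly q x * lifted x c t p"
  by (simp add: lifted_def map_poly_derivation_mult pderiv_mult algebra_simps)

text \<open>
  The forced value depends on p and not only on p(x), but it is additive in p; so it is enough that
  it vanishes whenever p(x) does.
\<close>

lemma derivation_extend:
  assumes compat: "\<And>p. p \<in> polys_over R \<Longrightarrow> poly p x = 0 \<Longrightarrow> lifted x c t p = 0"
  shows "\<exists>D'. derivation_on (adjoin R x) D' \<and> (\<forall>a\<in>R. D' a = c * D a) \<and> D' x = t"
proof -
  let ?F = "lifted x c t"
  define D' where "D' z = ?F (SOME p. p \<in> polys_over R \<and> poly p x = z)" for z
  have D': "D' (poly p x) = ?F p" if p: "p \<in> polys_over R" for p
  proof -
    define p' where "p' = (SOME p'. p' \<in> polys_over R \<and> poly p' x = poly p x)"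
    have p': "p' \<in> polys_over R" "poly p' x = poly p x"
      using someI[of "\<lambda>p'. p' \<in> polys_over R \<and> poly p' x = poly p x", OF conjI[OF p refl]]
      unfolding p'_def by auto
    have d: "p' - p \<in> polys_over R" using polys_over_closed(5)[OF R p'(1) p] .
    have "?F p' = ?F (p + (p' - p))" by simp
    also have "\<dots> = ?F p + ?F (p' - p)" by (rule lifted_add[OF p d])
    also have "?F (p' - p) = 0" using compat[OF d] p' by simp
    finally show ?thesis by (simp add: D'_def p'_def)
  qed
  have "derivation_on (adjoin R x) D'"
    unfolding derivation_on_def
  proof (intro ballI)
    fix a b assume "a \<in> adjoin R x" "b \<in> adjoin R x"
    then obtain p q where pq: "p \<in> polys_over R" "a = poly p x" "q \<in> polys_over R" "b = poly q x"
      by (auto simp: adjoin_def)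
    show "D' (a + b) = D' a + D' b \<and> D' (a * b) = a * D' b + b * D' a"
      using D'[OF polys_over_closed(3)[OF R pq(1,3)]] D'[OF polys_over_closed(4)[OF R pq(1,3)]] pq
      by (simp add: D' lifted_add lifted_mult)
  qed
  moreover have "D' a = c * D a" if "a \<in> R" for a
    using D'[OF polys_over_closed(1)[OF R that]] by (simp add: lifted_def map_poly_pCons derivation_0 pderiv_pCons)
  moreover have "D' x = t"
  proof -
    have D1: "D 1 = 0" using derivation_mult[OF is_subringD(1)[OF R] is_subringD(1)[OF R]]
      by (metis add_0_right add_left_cancel mult_1)
    have "[:0, 1:] \<in> polys_over R"
      using is_subringD[OF R] by (auto simp: polys_over_def coeff_pCons split: nat.split)
    from D'[OF this] show ?thesis
      by (simp add: lifted_def map_poly_pCons derivation_0 D1 pderiv_pCons)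
  qed
  ultimately show ?thesis by blast
qed

end

text \<open>
  If x is transcendental over R there is no compatibility condition. Otherwise let q be of minimal degree
  with q(x) = 0. The image t of x has to satisfy c q^D(x) + q'(x) t = 0, where q^D is q with D
  applied to its coefficients; as q'(x) \<noteq> 0, this is solved by c = q'(x) and t = - q^D(x).
  All other relations are multiples of q up to constants, so they impose no further condition.
\<close>

lemma derivation_extend_step:
  fixes R :: "'a::{idom,ring_char_0} set"
  assumes R: "is_subring R" and D: "derivation_on R D"
  shows "\<exists>c D'. c \<noteq> 0 \<and> derivation_on (adjoin R x) D' \<and> (\<forall>a\<in>R. D' a = c * D a)"
proof (cases "\<exists>p\<in>polys_over R. p \<noteq> 0 \<and> poly p x = 0")
  case True
  then obtain q where q: "minimal_vanishing R x q" using minimal_vanishing_exists by metis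
  then have qR: "q \<in> polys_over R" "poly q x = 0" by (auto simp: minimal_vanishing_def)
  define c where "c = poly (pderiv q) x"
  define t where "t = - poly (map_poly D q) x"
  have Fq: "lifted D x c t q = 0" by (simp add: lifted_def[OF R D] c_def t_def)
  have "lifted D x c t p = 0" if p: "p \<in> polys_over R" "poly p x = 0" for p
  proof -
    obtain e s where es: "e \<in> R" "e \<noteq> 0" "s \<in> polys_over R" "Polynomial.smult e p = q * s"
      using minimal_vanishing_dvd[OF R q p] .
    have "[:e:] * p = q * s" using es(4) by simp
    then have "lifted D x c t ([:e:] * p) = lifted D x c t (q * s)" by simp
    then have "e * lifted D x c t p = 0"
      using p(2) qR(2) Fq
      unfolding lifted_mult[OF R D polys_over_closed(1)[OF R es(1)] p(1)] lifted_mult[OF R D qR(1) es(3)]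
      by simp
    then show ?thesis using es by simp
  qed
  from derivation_extend[OF R D this] minimal_vanishing_pderiv[OF R q]
  show ?thesis unfolding c_def by blast
next
  case False
  have "lifted D x 1 0 p = 0" if p: "p \<in> polys_over R" "poly p x = 0" for p
  proof -
    have "p = 0" using False p by auto
    then show ?thesis by (simp add: lifted_def[OF R D])
  qed
  from derivation_extend[OF R D this] show ?thesis by (metis one_neq_zero)
qed

lemma derivation_extend_list:
  fixes R :: "'a::{idom,ring_char_0} set"
  assumes "is_subring R" "derivation_on R D"
  shows "\<exists>R' D' c. c \<noteq> 0 \<and> is_subring R' \<and> R \<subseteq> R' \<and> set xs \<subseteq> R' \<and> derivation_on R' D' \<and> (\<forall>a\<in>R. D' a = c * D a)"
proof (induction xs)
  case Nil
  show ?case using assms by (intro exI[of _ R] exI[of _ D] exI[of _ 1]) auto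
next
  case (Cons x xs)
  then obtain R' D' c where *: "c \<noteq> 0" "is_subring R'" "R \<subseteq> R'" "set xs \<subseteq> R'" "derivation_on R' D'"
    "\<forall>a\<in>R. D' a = c * D a" by blast
  obtain e D'' where **: "e \<noteq> 0" "derivation_on (adjoin R' x) D''" "\<forall>a\<in>R'. D'' a = e * D' a"
    using derivation_extend_step[OF *(2,5)] by blast
  have "e * c \<noteq> 0" "is_subring (adjoin R' x)" "R \<subseteq> adjoin R' x" "set (x # xs) \<subseteq> adjoin R' x"
    using * ** adjoin_subring[OF *(2), of x] by auto
  moreover have "\<forall>a\<in>R. D'' a = (e * c) * D a" using * ** by auto
  ultimately show ?case using ** by blast
qed

section \<open>The Jacobian criterion\<close>

lemma mpol_generated:
  fixes R :: "('n::finite, 'k::comm_ring_1) mpol set"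
  assumes R: "is_subring R" and sc: "\<And>c. scalar c \<in> R"
    and var: "\<And>i. Poly_Mapping.single (Poly_Mapping.single i 1) 1 \<in> R"
  shows "R = UNIV"
proof -
  have mono: "Poly_Mapping.single m 1 \<in> R" for m :: "'n \<Rightarrow>\<^sub>0 nat"
  proof (induction m rule: poly_mapping_monomial_induct)
    case (monom i k)
    show ?case
    proof (induction k)
      case 0
      show ?case using is_subringD(1)[OF R] by (simp add: single_one)
    next
      case (Suc k)
      have "Poly_Mapping.single (Poly_Mapping.single i (Suc k)) (1::'k)
          = Poly_Mapping.single (Poly_Mapping.single i 1) 1 * Poly_Mapping.single (Poly_Mapping.single i k) 1"
        by (simp add: mult_single flip: single_add)
      then show ?case using is_subringD(5)[OF R var Suc] by simp
    qed
  next
    case (add m m')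
    have "Poly_Mapping.single (m + m') (1::'k) = Poly_Mapping.single m 1 * Poly_Mapping.single m' 1"
      by (simp add: mult_single)
    then show ?case using is_subringD(5)[OF R add] by simp
  qed
  have "f \<in> R" for f
  proof (induction f rule: poly_mapping_monomial_induct)
    case (monom m c)
    have "Poly_Mapping.single m c = scalar c * Poly_Mapping.single m 1"
      by (simp add: scalar_def mult_single)
    then show ?case using is_subringD(5)[OF R sc mono] by simp
  qed (rule is_subringD(4)[OF R])
  then show ?thesis by auto
qed

lemma scalar_simps:
  "scalar 0 = 0" "scalar 1 = 1" "scalar (a + b) = scalar a + scalar b" "scalar (a * b) = scalar a * scalar b"
  "scalar (- a) = - scalar a"
  by (simp_all add: scalar_def single_add mult_single single_uminus)

lemma subalg_subring: "is_subring (subalg S)"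
proof -
  have "- a \<in> subalg S" if "a \<in> subalg S" for a
  proof -
    have "- a = scalar (- 1) * a" by (simp add: scalar_simps)
    then show ?thesis using subalg.mult[OF subalg.scalar[of "- 1"] that] by simp
  qed
  moreover have "1 \<in> subalg S" using subalg.scalar[of 1] by (simp add: scalar_simps)
  ultimately show ?thesis by (auto simp: is_subring_def intro: subalg.intros)
qed

text \<open>
  Both sides are k-linear derivations in h that agree on the variables, and the set on which two
  such derivations agree is a subring.
\<close>

lemma derivation_eq_sum_pdiff:
  fixes D :: "('n::{finite,linorder}, 'k::field_char_0) mpol \<Rightarrow> ('n, 'k) mpol"
  assumes D: "derivation_on UNIV D" and sc: "\<And>c. D (scalar c) = 0"
  shows "D h = (\<Sum>i\<in>UNIV. pdiff i h * D (Poly_Mapping.single (Poly_Mapping.single i 1) 1))"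
proof -
  let ?X = "\<lambda>i. Poly_Mapping.single (Poly_Mapping.single i 1) 1 :: ('n, 'k) mpol"
  let ?E = "\<lambda>h. \<Sum>i\<in>UNIV. pdiff i h * D (?X i)"
  have U: "is_subring (UNIV :: ('n, 'k) mpol set)" by (simp add: is_subring_def)
  note Dadd = derivation_add[OF U D UNIV_I UNIV_I] and Dmult = derivation_mult[OF U D UNIV_I UNIV_I]
  have E_scalar: "?E (scalar c) = 0" for c by simp
  have E_add: "?E (a + b) = ?E a + ?E b" for a b
    by (simp add: pdiff_add distrib_right sum.distrib)
  have E_mult: "?E (a * b) = a * ?E b + b * ?E a" for a b
    by (simp add: pdiff_mult distrib_right sum.distrib sum_distrib_left mult.assoc)
  let ?R = "{h. D h = ?E h}"
  have "is_subring ?R"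
    unfolding is_subring_def
  proof (intro conjI ballI)
    have one: "D 1 = 0" "?E 1 = 0" using sc[of 1] E_scalar[of 1] unfolding scalar_simps by simp_all
    then show "1 \<in> ?R" by simp
    fix a b assume ab: "a \<in> ?R" "b \<in> ?R"
    show "a + b \<in> ?R" using ab E_add[of a b] Dadd[of a b] by simp
    show "a * b \<in> ?R" using ab E_mult[of a b] Dmult[of a b] by simp
  next
    fix a assume a: "a \<in> ?R"
    have n: "- a = scalar (- 1) * a" by (simp add: scalar_simps)
    have "D (scalar (- 1) * a) = ?E (scalar (- 1) * a)"
      unfolding Dmult E_mult sc E_scalar using a by simp
    then show "- a \<in> ?R" unfolding n by blast
  qed
  moreover have "scalar c \<in> ?R" for c using sc E_scalar[of c] by simp
  moreover have "?X j \<in> ?R" for j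
  proof -
    have "pdiff i (?X j) = (if i = j then 1 else 0)" for i
      unfolding pdiff_single by (auto simp: lookup_single single_one)
    then have "?E (?X j) = (\<Sum>i\<in>UNIV. if i = j then D (?X j) else 0)"
      by (intro sum.cong) auto
    then show ?thesis by simp
  qed
  ultimately have "?R = UNIV" by (rule mpol_generated)
  then show ?thesis by blast
qed

definition eval_at :: "('n, 'k::comm_ring_1) mpol list \<Rightarrow> (nat, 'k) mpol \<Rightarrow> ('n, 'k) mpol"
  where "eval_at fs P = (\<Sum>m\<in>Poly_Mapping.keys P.
    scalar (Poly_Mapping.lookup P m) * (\<Prod>i<length fs. (fs ! i) ^ Poly_Mapping.lookup m i))"

lemma eval_at_superset:
  assumes "finite S" "Poly_Mapping.keys P \<subseteq> S"
  shows "eval_at fs P = (\<Sum>m\<in>S.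
    scalar (Poly_Mapping.lookup P m) * (\<Prod>i<length fs. (fs ! i) ^ Poly_Mapping.lookup m i))"
  unfolding eval_at_def using assms
  by (intro sum.mono_neutral_left) (auto simp: in_keys_iff scalar_simps)

lemma eval_at_add: "eval_at fs (P + Q) = eval_at fs P + eval_at fs Q"
  using keys_add[of P Q]
  by (simp add: eval_at_superset[of "Poly_Mapping.keys P \<union> Poly_Mapping.keys Q"] lookup_add
      scalar_simps distrib_right sum.distrib)

lemma eval_at_0: "eval_at fs 0 = 0"
  by (simp add: eval_at_def)

lemma eval_at_single:
  "eval_at fs (Poly_Mapping.single m c) = scalar c * (\<Prod>i<length fs. (fs ! i) ^ Poly_Mapping.lookup m i)"
  by (simp add: eval_at_superset[of "{m}"])

lemma eval_at_mult:
  fixes fs :: "('n, 'k::comm_ring_1) mpol list"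
  shows "eval_at fs (P * Q) = eval_at fs P * eval_at fs Q"
proof (induction P rule: poly_mapping_monomial_induct)
  case (monom m c)
  show ?case
  proof (induction Q rule: poly_mapping_monomial_induct)
    case (monom m' c')
    show ?case
      unfolding mult_single eval_at_single scalar_simps lookup_add power_add prod.distrib
      by (simp only: ac_simps)
  qed (simp add: distrib_left eval_at_add)
qed (simp_all add: distrib_right eval_at_add)

lemma eval_at_sum: "eval_at fs (sum f I) = (\<Sum>i\<in>I. eval_at fs (f i))"
  by (induction I rule: infinite_finite_induct) (simp_all add: eval_at_0 eval_at_add)

lemma eval_at_var:
  assumes "j < length fs"
  shows "eval_at fs (Poly_Mapping.single (Poly_Mapping.single j k) 1) = fs ! j ^ k"
proof -
  have "(\<Prod>i<length fs. (fs ! i) ^ Poly_Mapping.lookup (Poly_Mapping.single j k) i)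
      = (\<Prod>i<length fs. if i = j then fs ! j ^ k else 1)"
    by (rule prod.cong) (auto simp: lookup_single when_def)
  then show ?thesis using assms by (simp add: eval_at_single scalar_simps)
qed

lemma subalg_eval_at:
  fixes fs :: "('n, 'k::comm_ring_1) mpol list"
  assumes "h \<in> subalg ((!) fs ` N)" "N \<subseteq> {..<length fs}"
  shows "\<exists>P. eval_at fs P = h \<and> (\<forall>m\<in>Poly_Mapping.keys P. Poly_Mapping.keys m \<subseteq> N)"
  using assms(1)
proof induction
  case (scalar c)
  show ?case
    by (intro exI[of _ "Poly_Mapping.single 0 c"]) (simp add: eval_at_single)
next
  case (gen f)
  then obtain j where j: "j \<in> N" "f = fs ! j" by blast
  then have "eval_at fs (Poly_Mapping.single (Poly_Mapping.single j 1) 1) = f"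
    using eval_at_var[of j fs 1] assms(2) by auto
  then show ?case using j by (intro exI[of _ "Poly_Mapping.single (Poly_Mapping.single j 1) 1"]) simp
next
  case (add f h)
  then obtain P Q where "eval_at fs P = f" "\<forall>m\<in>Poly_Mapping.keys P. Poly_Mapping.keys m \<subseteq> N"
    "eval_at fs Q = h" "\<forall>m\<in>Poly_Mapping.keys Q. Poly_Mapping.keys m \<subseteq> N" by blast
  then show ?case using keys_add[of P Q] by (intro exI[of _ "P + Q"]) (auto simp: eval_at_add)
next
  case (mult f h)
  then obtain P Q where PQ: "eval_at fs P = f" "\<forall>m\<in>Poly_Mapping.keys P. Poly_Mapping.keys m \<subseteq> N"
    "eval_at fs Q = h" "\<forall>m\<in>Poly_Mapping.keys Q. Poly_Mapping.keys m \<subseteq> N" by blast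
  have "Poly_Mapping.keys m \<subseteq> N" if m: "m \<in> Poly_Mapping.keys (P * Q)" for m
  proof -
    obtain a b where "m = a + b" "a \<in> Poly_Mapping.keys P" "b \<in> Poly_Mapping.keys Q"
      using keys_mult[of P Q] m by blast
    then show ?thesis using keys_add[of a b] PQ by blast
  qed
  then show ?case using PQ by (intro exI[of _ "P * Q"]) (auto simp: eval_at_mult)
qed

lemma lookup_mult_monomial:
  fixes P :: "('a::cancel_comm_monoid_add) \<Rightarrow>\<^sub>0 'b::comm_ring_1"
  shows "Poly_Mapping.lookup (P * Poly_Mapping.single t 1) (m + t) = Poly_Mapping.lookup P m"
  by (induction P rule: poly_mapping_monomial_induct)
    (simp_all add: mult_single lookup_single when_def distrib_right lookup_add)

text \<open>
  A relation for f_j over the algebra generated by the other f_l lifts to a polynomial relation among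
  all of them: its coefficients are values of polynomials not involving the j-th variable,
  so monomials belonging to different powers of f_j cannot cancel.
\<close>

lemma alg_independent_transcendental:
  fixes fs :: "('n, 'k::comm_ring_1) mpol list"
  assumes indep: "alg_independent fs" and j: "j < length fs"
    and p: "p \<in> polys_over (subalg ((!) fs ` ({..<length fs} - {j})))" "poly p (fs ! j) = 0"
  shows "p = 0"
proof -
  let ?N = "{..<length fs} - {j}"
  let ?X = "\<lambda>i. Poly_Mapping.single (Poly_Mapping.single j i) 1 :: (nat, 'k) mpol"
  have "\<exists>P. eval_at fs P = Polynomial.coeff p i \<and> (\<forall>m\<in>Poly_Mapping.keys P. Poly_Mapping.keys m \<subseteq> ?N)" for i
    using p(1) by (intro subalg_eval_at) (auto simp: polys_over_def)
  then obtain P where P: "\<And>i. eval_at fs (P i) = Polynomial.coeff p i"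
    "\<And>i m. m \<in> Poly_Mapping.keys (P i) \<Longrightarrow> Poly_Mapping.keys m \<subseteq> ?N" by metis
  define Q where "Q = (\<Sum>i\<le>Polynomial.degree p. P i * ?X i)"
  have "eval_at fs Q = 0"
    using p(2) by (simp add: Q_def eval_at_sum eval_at_mult P(1) eval_at_var[OF j] poly_altdef)
  moreover have "Poly_Mapping.keys m \<subseteq> {..<length fs}" if mQ: "m \<in> Poly_Mapping.keys Q" for m
  proof -
    obtain i where "m \<in> Poly_Mapping.keys (P i * ?X i)"
      using keys_sum[of "\<lambda>i. P i * ?X i" "{..Polynomial.degree p}"] mQ unfolding Q_def by blast
    then obtain a b where ab: "m = a + b" "a \<in> Poly_Mapping.keys (P i)" "b \<in> Poly_Mapping.keys (?X i)"
      using keys_mult[of "P i" "?X i"] by blast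
    then have "b = Poly_Mapping.single j i" by (simp split: if_splits)
    then have "Poly_Mapping.keys b \<subseteq> {j}" by simp
    then show ?thesis using ab P(2)[OF ab(2)] keys_add[of a b] j by auto
  qed
  ultimately have "Q = 0"
    using indep unfolding alg_independent_def eval_at_def by blast
  have "P i = 0" if i: "i \<le> Polynomial.degree p" for i
  proof (rule poly_mapping_eqI)
    fix m
    show "Poly_Mapping.lookup (P i) m = Poly_Mapping.lookup 0 m"
    proof (cases "m \<in> Poly_Mapping.keys (P i)")
      case True
      then have mj: "Poly_Mapping.lookup m j = 0" using P(2)[OF True] by (auto simp: in_keys_iff)
      have "Poly_Mapping.lookup (P l * ?X l) (m + Poly_Mapping.single j i)
          = (if l = i then Poly_Mapping.lookup (P i) m else 0)" for l
      proof (cases "l = i")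
        case False
        have "m + Poly_Mapping.single j i \<notin> Poly_Mapping.keys (P l * ?X l)"
        proof
          assume "m + Poly_Mapping.single j i \<in> Poly_Mapping.keys (P l * ?X l)"
          then obtain a b where ab: "m + Poly_Mapping.single j i = a + b" "a \<in> Poly_Mapping.keys (P l)"
            "b \<in> Poly_Mapping.keys (?X l)"
            using keys_mult[of "P l" "?X l"] by blast
          then have "b = Poly_Mapping.single j l" by (simp split: if_splits)
          moreover have "Poly_Mapping.lookup a j = 0" using P(2)[OF ab(2)] by (auto simp: in_keys_iff)
          moreover have "Poly_Mapping.lookup (m + Poly_Mapping.single j i) j = Poly_Mapping.lookup (a + b) j"
            using ab by simp
          ultimately show False using mj False by (simp add: lookup_add)
        qed
        then show ?thesis using False by (simp add: in_keys_iff)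
      qed (simp add: lookup_mult_monomial)
      then have "Poly_Mapping.lookup Q (m + Poly_Mapping.single j i) = Poly_Mapping.lookup (P i) m"
        using i by (simp add: Q_def lookup_sum)
      then show ?thesis using \<open>Q = 0\<close> by simp
    qed (simp add: in_keys_iff)
  qed
  then have "Polynomial.coeff p i = 0" if "i \<le> Polynomial.degree p" for i
    using P(1)[of i] that by (simp add: eval_at_0)
  from this[of "Polynomial.degree p"] show ?thesis by simp
qed

text \<open>
  Take the zero derivation on the algebra generated by the f_l with l \<noteq> j. As f_j is transcendental over
  it, this extends to a derivation that is 1 at f_j. Adjoining all variables extends a nonzero multiple of
  it to the whole polynomial ring, where its values at the variables are the components of v.
\<close>

lemma alg_independent_dual_vector:
  fixes fs :: "('n::{finite,linorder}, 'k::field_char_0) mpol list"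
  assumes indep: "alg_independent fs" and j: "j < length fs"
  shows "\<exists>v. (\<Sum>i\<in>UNIV. pdiff i (fs ! j) * v i) \<noteq> 0 \<and>
     (\<forall>l<length fs. l \<noteq> j \<longrightarrow> (\<Sum>i\<in>UNIV. pdiff i (fs ! l) * v i) = 0)"
proof -
  let ?R = "subalg ((!) fs ` ({..<length fs} - {j}))"
  let ?X = "\<lambda>i. Poly_Mapping.single (Poly_Mapping.single i 1) 1 :: ('n, 'k) mpol"
  have R: "is_subring ?R" by (rule subalg_subring)
  have D0: "derivation_on ?R (\<lambda>_. 0)" by (simp add: derivation_on_def)
  have "lifted (\<lambda>_. 0) (fs ! j) 1 1 p = 0" if "p \<in> polys_over ?R" "poly p (fs ! j) = 0" for p
    using alg_independent_transcendental[OF indep j that] by (simp add: lifted_def[OF R D0])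
  from derivation_extend[OF R D0 this] obtain D1
    where D1: "derivation_on (adjoin ?R (fs ! j)) D1" "\<forall>a\<in>?R. D1 a = 1 * 0" "D1 (fs ! j) = 1"
    by blast
  obtain xs :: "'n list" where xs: "set xs = UNIV" using finite_list[OF finite_UNIV] by blast
  obtain R' D c where *: "c \<noteq> 0" "is_subring R'" "adjoin ?R (fs ! j) \<subseteq> R'" "set (map ?X xs) \<subseteq> R'"
    "derivation_on R' D" "\<forall>a\<in>adjoin ?R (fs ! j). D a = c * D1 a"
    using derivation_extend_list[OF adjoin_subring(1)[OF R] D1(1), of "map ?X xs"] by blast
  have sub: "?R \<subseteq> adjoin ?R (fs ! j)" and mem: "fs ! j \<in> adjoin ?R (fs ! j)"
    using adjoin_subring[OF R] by auto
  have "?X i \<in> R'" for i using *(4) xs by auto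
  moreover have "scalar c \<in> R'" for c using *(3) sub subalg.scalar by blast
  ultimately have UN: "R' = UNIV" by (intro mpol_generated[OF *(2)])
  have D0: "D a = 0" if "a \<in> ?R" for a using *(6) D1(2) sub that by auto
  have Dsum: "D h = (\<Sum>i\<in>UNIV. pdiff i h * D (?X i))" for h
    using *(5) D0[OF subalg.scalar] unfolding UN by (rule derivation_eq_sum_pdiff)
  have "D (fs ! j) = c" using *(6) D1(3) mem by auto
  moreover have "D (fs ! l) = 0" if "l < length fs" "l \<noteq> j" for l
    using that by (intro D0 subalg.gen) auto
  ultimately have "D (fs ! j) \<noteq> 0 \<and> (\<forall>l<length fs. l \<noteq> j \<longrightarrow> D (fs ! l) = 0)"
    using *(1) by simp
  then show ?thesis
    unfolding Dsum[of "fs ! _"] by (intro exI[of _ "\<lambda>i. D (?X i)"])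
qed

lemma jacobian_criterion:
  fixes fs :: "('n::{finite,linorder}, 'k::field_char_0) mpol list"
  assumes "alg_independent fs"
  shows "\<exists>L. wedge_differentials fs L \<noteq> 0"
  using alg_independent_dual_vector[OF assms] by (rule wedge_differentials_nonzero)

section \<open>Degrees of simple extensions\<close>

lemma ring_of_type_algebra_simps:
  "carrier ring_of_type_algebra = UNIV" "x \<otimes>\<^bsub>ring_of_type_algebra\<^esub> y = x * y"
  "x \<oplus>\<^bsub>ring_of_type_algebra\<^esub> y = x + y" "\<one>\<^bsub>ring_of_type_algebra\<^esub> = 1" "\<zero>\<^bsub>ring_of_type_algebra\<^esub> = 0"
  by (simp_all add: ring_of_type_algebra_def)

text \<open>
  The field F(x) coincides with F[x] because x is algebraic, and its dimension is the degree of the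
  minimal polynomial of x, which divides every polynomial over F vanishing at x.
\<close>

lemma adjoin_degree_bounds:
  fixes F :: "'a::field set"
  assumes F: "is_subring F" "\<And>a. a \<in> F \<Longrightarrow> inverse a \<in> F" and alg: "algebraic_over F x"
  shows "adjoin_degree F x \<ge> 1"
    and "q \<in> polys_over F \<Longrightarrow> q \<noteq> 0 \<Longrightarrow> poly q x = 0 \<Longrightarrow> adjoin_degree F x \<le> Polynomial.degree q"
proof -
  let ?R = "ring_of_type_algebra :: 'a ring"
  note simps = ring_of_type_algebra_simps
  interpret R: field ?R by (rule field_from_type_algebra)
  have uminus: "\<ominus>\<^bsub>?R\<^esub> a = - a" for a
    using R.minus_equality[of "- a" a] by (simp add: simps)
  have inv: "inv\<^bsub>?R\<^esub> a = inverse a" if "a \<noteq> 0" for a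
    using that by (intro R.inv_char) (simp_all add: simps)
  have sr: "subring F ?R"
    using is_subringD[OF F(1)] by (intro R.subringI) (simp_all add: simps uminus)
  have sf: "subfield F ?R"
    using F(2) by (intro R.subfieldI'[OF sr]) (simp add: simps inv)
  have xc: "x \<in> carrier ?R" by (simp add: simps)
  have alg': "R.algebraic F x" using alg by (simp add: algebraic_over_def)
  have alg'': "(R.algebraic over F) x" using alg' by (simp add: over_def)
  have gen: "generate_field ?R (insert x F) = R.simple_extension F x"
  proof (rule R.generate_fieldI[symmetric])
    show "insert x F \<subseteq> carrier ?R" by (simp add: simps)
    show "subfield (R.simple_extension F x) ?R"
      using R.simple_extension_is_subfield[OF sf xc] alg'' by blast
    show "insert x F \<subseteq> R.simple_extension F x"
      using R.simple_extension_mem[OF sr xc] R.simple_extension_incl[OF _ xc, of F] by (simp add: simps)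
    fix K assume "subfield K ?R" "insert x F \<subseteq> K"
    then show "R.simple_extension F x \<subseteq> K"
      using R.simple_extension_subring_incl[OF subfieldE(1)] by auto
  qed
  have d: "adjoin_degree F x = length (R.Irr F x) - 1"
    using R.simple_extension_dim[OF sf xc alg''] by (simp add: adjoin_degree_def gen over_def)
  show "adjoin_degree F x \<ge> 1"
    unfolding d by (rule R.pirreducible_degree[OF sf R.IrrE(1,2)[OF sf xc alg'']])
  assume q: "q \<in> polys_over F" "q \<noteq> 0" "poly q x = 0"
  let ?p = "rev (coeffs q)"
  have pow: "a [^]\<^bsub>?R\<^esub> (n::nat) = a ^ n" for a n
    by (induction n) (simp_all add: simps)
  have eval: "R.eval ps x = poly (Poly (rev ps)) x" for ps
    by (induction ps) (simp_all add: simps pow Poly_snoc poly_monom add.commute)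
  have "set ?p \<subseteq> F"
    using q(1) by (auto simp: polys_over_def coeffs_def)
  moreover have "hd ?p \<noteq> 0" using q(2) by (simp add: hd_rev last_coeffs_eq_coeff_degree)
  ultimately have pc: "?p \<in> carrier (univ_poly ?R F)"
    by (simp add: polynomial_def simps flip: univ_poly_carrier)
  have "R.eval ?p x = \<zero>\<^bsub>?R\<^esub>" unfolding eval using q(3) by (simp add: simps)
  then have "(R.Irr F x) pdivides\<^bsub>?R\<^esub> ?p"
    by (rule R.Irr_minimal[OF sf xc alg'' pc])
  then have "length (R.Irr F x) - 1 \<le> length ?p - 1"
    using R.pdivides_imp_degree_le[OF sr R.IrrE(1)[OF sf xc alg''] pc] q(2) by simp
  then show "adjoin_degree F x \<le> Polynomial.degree q"
    unfolding d length_rev length_coeffs_degree[OF q(2)] by (simp only: diff_Suc_1)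
qed

lemma Fract_in_frac_field:
  "a \<in> A \<Longrightarrow> b \<in> A \<Longrightarrow> b \<noteq> 0 \<Longrightarrow> Fraction_Field.Fract a b \<in> frac_field A"
  unfolding frac_field_def by (intro CollectI exI[of _ a] exI[of _ b] conjI refl)

lemma frac_field_subfield:
  fixes A :: "'a::idom set"
  assumes A: "is_subring A"
  shows "is_subring (frac_field A)" "x \<in> frac_field A \<Longrightarrow> inverse x \<in> frac_field A"
proof -
  note A' = is_subringD[OF A]
  show "is_subring (frac_field A)"
    unfolding is_subring_def
  proof (intro conjI ballI)
    show "1 \<in> frac_field A"
      unfolding One_fract_def by (intro Fract_in_frac_field A'(1) one_neq_zero)
    fix x y assume "x \<in> frac_field A" "y \<in> frac_field A"
    then obtain a b c d where x: "x = Fraction_Field.Fract a b" "a \<in> A" "b \<in> A" "b \<noteq> 0"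
      and y: "y = Fraction_Field.Fract c d" "c \<in> A" "d \<in> A" "d \<noteq> 0" by (auto simp: frac_field_def)
    have "x + y = Fraction_Field.Fract (a * d + c * b) (b * d)" "x * y = Fraction_Field.Fract (a * c) (b * d)"
      using x y by simp_all
    moreover have "b * d \<in> A" "b * d \<noteq> 0" "a * d + c * b \<in> A" "a * c \<in> A" using x y A' by auto
    ultimately show "x + y \<in> frac_field A" "x * y \<in> frac_field A"
      by (auto simp del: mult_eq_0_iff intro: Fract_in_frac_field)
  next
    fix x assume "x \<in> frac_field A"
    then obtain a b where x: "x = Fraction_Field.Fract a b" "a \<in> A" "b \<in> A" "b \<noteq> 0"
      by (auto simp: frac_field_def)
    then have "- x = Fraction_Field.Fract (- a) b" by simp
    then show "- x \<in> frac_field A" using x A' by (auto intro: Fract_in_frac_field)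
  qed
  assume "x \<in> frac_field A"
  then obtain a b where x: "x = Fraction_Field.Fract a b" "a \<in> A" "b \<in> A" "b \<noteq> 0"
    by (auto simp: frac_field_def)
  show "inverse x \<in> frac_field A"
  proof (cases "a = 0")
    case True
    then have "x = 0" using x by (simp add: Zero_fract_def eq_fract)
    then show ?thesis using \<open>x \<in> frac_field A\<close> by simp
  next
    case False
    then show ?thesis using x by (auto intro: Fract_in_frac_field)
  qed
qed

text \<open>
  A polynomial over A is in particular one over the field of fractions. The lower bound ensures that
  dividing by the degree is meaningful.
\<close>

lemma adjoin_degree_frac_field_bounds:
  fixes A :: "'a::idom set"
  assumes A: "is_subring A" and alg: "algebraic_over (frac_field A) (Fraction_Field.Fract x 1)"
  shows "adjoin_degree (frac_field A) (Fraction_Field.Fract x 1) \<ge> 1"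
    and "q \<in> polys_over A \<Longrightarrow> q \<noteq> 0 \<Longrightarrow> poly q x = 0 \<Longrightarrow>
      adjoin_degree (frac_field A) (Fraction_Field.Fract x 1) \<le> Polynomial.degree q"
proof -
  note bounds = adjoin_degree_bounds[OF frac_field_subfield[OF A] alg]
  show "adjoin_degree (frac_field A) (Fraction_Field.Fract x 1) \<ge> 1" by (rule bounds)
  assume q: "q \<in> polys_over A" "q \<noteq> 0" "poly q x = 0"
  let ?e = "\<lambda>a. Fraction_Field.Fract a (1::'a)"
  have e0: "?e a = 0 \<longleftrightarrow> a = 0" for a by (simp add: Zero_fract_def eq_fract)
  have e: "?e 0 = 0" by (simp add: e0)
  let ?q = "map_poly ?e q"
  have "?q \<in> polys_over (frac_field A)"
    using q(1) is_subringD(1)[OF A] by (auto simp: polys_over_def coeff_map_poly e intro: Fract_in_frac_field)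
  moreover have "?q \<noteq> 0"
    using q(2) by (metis coeff_map_poly[of ?e, OF e] coeff_0 e0 poly_eqI)
  moreover have "poly (map_poly ?e p) (?e x) = ?e (poly p x)" for p
    by (induction p) (simp_all add: map_poly_pCons e)
  then have "poly ?q (?e x) = 0" by (simp add: q(3) e)
  ultimately have "adjoin_degree (frac_field A) (?e x) \<le> Polynomial.degree ?q" by (intro bounds(2))
  then show "adjoin_degree (frac_field A) (?e x) \<le> Polynomial.degree q"
    using e0 by (simp add: degree_map_poly)
qed

section \<open>Multiplicities of roots\<close>

lemma order_pderivs:
  fixes p :: "'a::{idom,ring_char_0} poly"
  assumes "p \<noteq> 0" "i \<le> order x p"
  shows "(pderiv ^^ i) p \<noteq> 0 \<and> order x ((pderiv ^^ i) p) = order x p - i"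
  using assms(2)
proof (induction i)
  case (Suc i)
  let ?q = "(pderiv ^^ i) p"
  have q: "?q \<noteq> 0" "order x ?q = order x p - i" using Suc by auto
  then have "poly ?q x = 0" using Suc.prems by (simp add: order_root)
  have "pderiv ?q \<noteq> 0"
  proof
    assume "pderiv ?q = 0"
    then obtain c where "?q = [:c:]" using degree_eq_zeroE unfolding pderiv_eq_0_iff by blast
    then show False using q \<open>poly ?q x = 0\<close> by simp
  qed
  moreover have "order x ?q = Suc (order x (pderiv ?q))"
    using q \<open>poly ?q x = 0\<close> by (intro order_pderiv)
  ultimately show ?case using q by simp
qed (use assms in simp)

lemma order_eq_1:
  fixes x :: "'a::{idom,ring_char_0}"
  assumes R: "is_subring R" and q: "minimal_vanishing R x q"
  shows "order x q = 1"
  using order_pderiv[of q x] order_0I[OF minimal_vanishing_pderiv[OF R q]] q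
  by (simp add: minimal_vanishing_def)

text \<open>
  Each zero of p at x allows one factor q to be split off up to constants; as the zero of q is simple,
  this reduces the multiplicity by exactly one.
\<close>

lemma order_times_degree_le:
  fixes x :: "'a::{idom,ring_char_0}"
  assumes R: "is_subring R" and q: "minimal_vanishing R x q" and p: "p \<in> polys_over R" "p \<noteq> 0"
  shows "order x p * Polynomial.degree q \<le> Polynomial.degree p"
  using p
proof (induction "order x p" arbitrary: p)
  case (Suc n)
  have "poly p x = 0" using Suc by (simp add: order_root)
  then obtain c s where cs: "c \<in> R" "c \<noteq> 0" "s \<in> polys_over R" "Polynomial.smult c p = q * s"
    using minimal_vanishing_dvd[OF R q Suc.prems(1)] by blast
  have nz: "q * s \<noteq> 0" using cs Suc.prems by (metis smult_eq_0_iff)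
  have "Suc n = 1 + order x s"
    using order_smult[OF cs(2), of x p] order_mult[OF nz, of x] order_eq_1[OF R q] cs(4) Suc.hyps(2) by simp
  then have n: "n = order x s" by simp
  have "Polynomial.degree p = Polynomial.degree q + Polynomial.degree s"
    using degree_mult_eq[of q s] nz cs(2,4) by (metis degree_smult_eq mult_eq_0_iff)
  moreover have "order x s * Polynomial.degree q \<le> Polynomial.degree s"
    using Suc.hyps(1)[OF n cs(3)] nz by simp
  ultimately show ?case using Suc.hyps(2) n by (metis add_le_mono le_refl mult_Suc)
qed simp

text \<open>
  Every relation is a multiple of the generator, so none has smaller degree.
\<close>

lemma generator_minimal_vanishing:
  fixes x :: "'a::idom"
  assumes R: "is_subring R" and P: "generates_in R P (subst_kernel R x)" and nz: "P \<noteq> 0"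
  shows "minimal_vanishing R x P"
proof -
  have PR: "P \<in> polys_over R" and ker: "subst_kernel R x = {P * Q | Q. Q \<in> polys_over R}"
    using P by (auto simp: generates_in_def)
  have "[:1:] \<in> polys_over R" by (rule polys_over_closed(1)[OF R is_subringD(1)[OF R]])
  then have "P * 1 \<in> subst_kernel R x" unfolding ker one_pCons by blast
  moreover have "Polynomial.degree P \<le> Polynomial.degree p" if "p \<in> polys_over R" "p \<noteq> 0" "poly p x = 0" for p
  proof -
    have "p \<in> subst_kernel R x" using that by (simp add: subst_kernel_def)
    then obtain Q where Q: "p = P * Q" unfolding ker by blast
    then show ?thesis using that degree_mult_eq[of P Q] by auto
  qed
  ultimately show ?thesis using nz PR by (auto simp: minimal_vanishing_def subst_kernel_def)
qed

lemma generator_power_factor: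
  fixes x :: "'a::{idom,ring_char_0}"
  assumes R: "is_subring R" and P: "generates_in R P (subst_kernel R x)" and nz: "P \<noteq> 0"
    and p: "p \<in> polys_over R" "p \<noteq> 0"
  shows "\<exists>Q\<in>polys_over R. p = P ^ order x p * Q"
  using p
proof (induction "order x p" arbitrary: p)
  case 0
  then show ?case by (metis mult_1 power_0)
next
  case (Suc n)
  have "poly p x = 0" using Suc by (simp add: order_root)
  then have "p \<in> subst_kernel R x" using Suc by (simp add: subst_kernel_def)
  then obtain s where s: "s \<in> polys_over R" "p = P * s" using P by (auto simp: generates_in_def)
  then have "P * s \<noteq> 0" using Suc by simp
  from order_mult[OF this, of x] have n: "n = order x s"
    using order_eq_1[OF R generator_minimal_vanishing[OF R P nz]] s Suc.hyps(2) by simp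
  then obtain Q where Q: "Q \<in> polys_over R" "s = P ^ order x s * Q"
    using Suc.hyps(1)[OF n s(1)] s Suc by auto
  have "p = P ^ Suc n * Q" using Q(2) n s(2) by (simp add: mult.assoc)
  then show ?case using Q Suc.hyps(2) by auto
qed

section \<open>The initial algebra\<close>

lemma initial_algebra_subring: "is_subring (initial_algebra w A)"
  unfolding initial_algebra_def by (rule subalg_subring)

lemma wcomp_in_initial_algebra:
  assumes "h \<in> A" "wdeg w h \<le> Fin \<gamma>"
  shows "wcomp w \<gamma> h \<in> initial_algebra w A"
proof (cases "wcomp w \<gamma> h = 0")
  case True
  then show ?thesis using is_subringD(2)[OF initial_algebra_subring] by metis
next
  case False
  then have "wdeg w h = Fin \<gamma>" using assms(2) by (simp add: wdeg_eq_Fin_iff)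
  then have "init_form w h = wcomp w \<gamma> h" by (rule init_form_eq)
  moreover have "h \<noteq> 0" using False by auto
  ultimately show ?thesis
    unfolding initial_algebra_def using assms(1) by (metis DiffI imageI singletonD subalg.gen)
qed

text \<open>
  The property that all occurring monomials have nonnegative weight passes to sums and products,
  unlike a bound from below on the degree, and the generators have it because they are homogeneous.
\<close>

lemma wdeg_initial_algebra_nonneg:
  assumes A: "\<forall>h\<in>A - {0}. wdeg w h \<ge> 0" and h: "h \<in> initial_algebra w A" "h \<noteq> 0"
  shows "wdeg w h \<ge> 0"
proof -
  have "\<forall>m\<in>Poly_Mapping.keys h. weight w m \<ge> 0"
    using h(1) unfolding initial_algebra_def
  proof induction
    case (gen f)
    then obtain a where a: "a \<in> A" "a \<noteq> 0" "f = init_form w a" by blast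
    then obtain \<gamma> where \<gamma>: "wdeg w a = Fin \<gamma>" using wdeg_nonzeroE by metis
    moreover have "wdeg w a \<ge> 0" using A a by blast
    ultimately have "\<gamma> \<ge> 0" by (simp add: zero_extended_def)
    then show ?case unfolding a(3) init_form_eq[OF \<gamma>] keys_wcomp by simp
  next
    case (add f h)
    then show ?case using keys_add[of f h] by blast
  next
    case (mult f h)
    then show ?case using keys_mult[of f h] by (fastforce simp: weight_add)
  qed (auto simp: scalar_def)
  moreover obtain m where "m \<in> Poly_Mapping.keys h" using h(2) by (metis all_not_in_conv keys_eq_empty)
  ultimately show ?thesis using h(2) by (auto simp: wdeg_eq_Max zero_extended_def Max_ge_iff)
qed

lemma ycomp_over_initial_algebra:
  assumes "\<Phi> \<in> polys_over A" "ydeg_le w \<delta> \<mu> \<Phi>"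
  shows "ycomp w \<delta> \<mu> \<Phi> \<in> polys_over (initial_algebra w A)"
  using assms by (auto simp: polys_over_def coeff_ycomp ydeg_le_def intro: wcomp_in_initial_algebra)

text \<open>
  The summand of highest degree in y alone already forces deg^g \<Phi> to be this large.
\<close>

lemma leading_summand_le:
  assumes "ydeg_le w \<delta> \<mu> \<Phi>" "wdeg w (lead_coeff \<Phi>) \<ge> 0"
  shows "ncopies (Polynomial.degree \<Phi>) \<delta> \<le> \<mu>"
proof -
  have "Fin 0 \<le> wdeg w (lead_coeff \<Phi>)" using assms(2) by (simp add: zero_extended_def)
  also have "\<dots> \<le> Fin (\<mu> - ncopies (Polynomial.degree \<Phi>) \<delta>)" using assms(1) by (simp add: ydeg_le_def)
  finally show ?thesis by simp
qed

section \<open>The generalized Shestakov-Umirbaev inequality\<close>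

context
  fixes w :: "'n::{finite,linorder} \<Rightarrow> 'v::linordered_ab_group_add"
    and g :: "('n, 'k::field_char_0) mpol" and \<delta> :: 'v
  assumes g: "wdeg w g = Fin \<delta>"
begin

text \<open>
  Up to the multiplicity m of the root, the derivatives of the leading part are nonzero polynomials, so
  the i-th derivative of \<Phi> has expected degree \<mu> - i \<delta>. Its value at g attains this degree
  exactly if the i-th derivative of the leading part is nonzero at the initial form of g, which for
  i \<le> m happens first at i = m.
\<close>

lemma
  assumes \<mu>: "wdeg_at w g \<Phi> = Fin \<mu>"
  defines "m \<equiv> order (init_form w g) (ycomp w \<delta> \<mu> \<Phi>)"
  shows m_at_eq_order: "m_at w g \<Phi> = m"
    and wdeg_pderivs_order: "wdeg w (poly ((pderiv ^^ m) \<Phi>) g) = Fin (\<mu> - ncopies m \<delta>)"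
proof -
  let ?\<Psi> = "ycomp w \<delta> \<mu> \<Phi>"
  have \<Phi>: "ydeg_le w \<delta> \<mu> \<Phi>" "?\<Psi> \<noteq> 0" using \<mu> wdeg_at_eq_iff[OF g] by auto
  have at: "wdeg_at w g ((pderiv ^^ i) \<Phi>) = Fin (\<mu> - ncopies i \<delta>)"
    and val: "wdeg w (poly ((pderiv ^^ i) \<Phi>) g) = Fin (\<mu> - ncopies i \<delta>) \<longleftrightarrow> i = m" if i: "i \<le> m" for i
  proof -
    have le: "ydeg_le w \<delta> (\<mu> - ncopies i \<delta>) ((pderiv ^^ i) \<Phi>)" by (rule ydeg_le_pderivs[OF \<Phi>(1)])
    have o: "(pderiv ^^ i) ?\<Psi> \<noteq> 0" "order (init_form w g) ((pderiv ^^ i) ?\<Psi>) = m - i"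
      using order_pderivs[OF \<Phi>(2)] i unfolding m_def by auto
    show "wdeg_at w g ((pderiv ^^ i) \<Phi>) = Fin (\<mu> - ncopies i \<delta>)"
      using le o(1) by (simp add: wdeg_at_eq_iff[OF g] ycomp_pderivs)
    have "wdeg w (poly ((pderiv ^^ i) \<Phi>) g) = Fin (\<mu> - ncopies i \<delta>)
        \<longleftrightarrow> poly ((pderiv ^^ i) ?\<Psi>) (init_form w g) \<noteq> 0"
      unfolding wdeg_eq_Fin_iff wcomp_poly[OF g le] ycomp_pderivs using wdeg_poly_le[OF g le] by simp
    also have "\<dots> \<longleftrightarrow> i = m" using o i by (auto simp: order_root)
    finally show "wdeg w (poly ((pderiv ^^ i) \<Phi>) g) = Fin (\<mu> - ncopies i \<delta>) \<longleftrightarrow> i = m" .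
  qed
  show "wdeg w (poly ((pderiv ^^ m) \<Phi>) g) = Fin (\<mu> - ncopies m \<delta>)" using val[of m] by simp
  then show "m_at w g \<Phi> = m"
    unfolding m_at_def
  proof (intro Least_equality)
    fix i assume i: "wdeg_at w g ((pderiv ^^ i) \<Phi>) = wdeg w (poly ((pderiv ^^ i) \<Phi>) g)"
    show "m \<le> i"
    proof (rule ccontr)
      assume "\<not> m \<le> i"
      then show False using at[of i] val[of i] i by simp
    qed
  qed (simp add: at)
qed

end

context
  fixes w :: "'n::{finite,linorder} \<Rightarrow> 'v::linordered_ab_group_add"
    and fs :: "('n, 'k::field_char_0) mpol list"
    and g :: "('n, 'k) mpol" and \<delta> \<sigma> :: 'v and M :: "'v extended"
  assumes g: "wdeg w g = Fin \<delta>"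
    and \<omega>: "form_wdeg w (wedge_differentials fs) = Fin \<sigma>"
  defines "M \<equiv> form_wdeg w (wedge (wedge_differentials fs) (differential g))
    - form_wdeg w (wedge_differentials fs) - wdeg w g"
begin

text \<open>
  M is \<open>Minf\<close> when \<omega> \<and> dg = 0, which happens if g is algebraic over k(f_1, ..., f_r). In the other
  case M \<le> 0, because deg (\<omega> \<and> dg) \<le> deg \<omega> + deg dg and deg dg \<le> deg g.
\<close>

lemma defect_cases:
  obtains "M = Minf" | \<kappa> where "M = Fin \<kappa>" "\<kappa> \<le> 0"
    "form_wdeg w (wedge (wedge_differentials fs) (differential g)) = Fin (\<sigma> + \<kappa> + \<delta>)"
proof (cases "form_wdeg w (wedge (wedge_differentials fs) (differential g))")
  case (Fin \<tau>)
  have "form_wdeg w (wedge (wedge_differentials fs) (differential g)) \<le> Fin \<sigma> + form_wdeg w (differential g)"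
    unfolding \<omega>[symmetric] by (rule form_wdeg_wedge_le)
  also have "\<dots> \<le> Fin \<sigma> + Fin \<delta>"
    unfolding g[symmetric] by (intro add_left_mono form_wdeg_differential_le)
  finally have "\<tau> - \<sigma> - \<delta> \<le> 0" by (simp add: Fin algebra_simps)
  moreover have "M = Fin (\<tau> - \<sigma> - \<delta>)" by (simp add: M_def \<omega> g Fin)
  ultimately show ?thesis using that(2)[of "\<tau> - \<sigma> - \<delta>"] Fin by (simp add: algebra_simps)
qed (simp_all add: form_wdeg_neq_Pinf that(1) M_def \<omega> g)

text \<open>
  Compare degrees in \<omega> \<and> d(\<Psi>(g)) = \<Psi>'(g) \<omega> \<and> dg: the right-hand side is exact, as degrees add under
  multiplication by a polynomial, and the left-hand side is at most deg \<omega> + deg \<Psi>(g).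
\<close>

lemma wdeg_pderiv_plus_defect_le:
  assumes \<Psi>: "\<Psi> \<in> polys_over (subalg (set fs))" and M: "M = Fin \<kappa>"
  shows "wdeg w (poly (pderiv \<Psi>) g) + Fin (\<kappa> + \<delta>) \<le> wdeg w (poly \<Psi> g)"
proof -
  let ?\<omega> = "wedge_differentials fs"
  have \<tau>: "form_wdeg w (wedge ?\<omega> (differential g)) = Fin (\<sigma> + \<kappa> + \<delta>)"
    by (rule defect_cases) (use M in auto)
  have "wedge ?\<omega> (differential (poly \<Psi> g)) = (\<lambda>L. poly (pderiv \<Psi>) g * wedge ?\<omega> (differential g) L)"
    using \<Psi> by (intro wedge_differential_poly wedge_differential_subalg polys_over_coeff)
  then have "wdeg w (poly (pderiv \<Psi>) g) + Fin (\<sigma> + \<kappa> + \<delta>) = form_wdeg w (wedge ?\<omega> (differential (poly \<Psi> g)))"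
    by (simp add: form_wdeg_scale \<tau>)
  also have "\<dots> \<le> form_wdeg w ?\<omega> + form_wdeg w (differential (poly \<Psi> g))" by (rule form_wdeg_wedge_le)
  also have "\<dots> \<le> Fin \<sigma> + wdeg w (poly \<Psi> g)"
    unfolding \<omega> by (intro add_left_mono form_wdeg_differential_le)
  finally show ?thesis
    by (cases "wdeg w (poly (pderiv \<Psi>) g)"; cases "wdeg w (poly \<Psi> g)") (auto simp: algebra_simps)
qed

lemma wdeg_pderivs_plus_defect_le:
  assumes \<Psi>: "\<Psi> \<in> polys_over (subalg (set fs))" and M: "M = Fin \<kappa>"
  shows "wdeg w (poly ((pderiv ^^ i) \<Psi>) g) + Fin (ncopies i (\<kappa> + \<delta>)) \<le> wdeg w (poly \<Psi> g)"
proof (induction i)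
  case 0
  show ?case by (simp flip: zero_extended_def)
next
  case (Suc i)
  have "(pderiv ^^ i) \<Psi> \<in> polys_over (subalg (set fs))"
    by (induction i) (simp_all add: \<Psi> polys_over_closed(8)[OF subalg_subring])
  from add_right_mono[OF wdeg_pderiv_plus_defect_le[OF this M], of "Fin (ncopies i (\<kappa> + \<delta>))"]
  have "wdeg w (poly ((pderiv ^^ Suc i) \<Psi>) g) + Fin (ncopies (Suc i) (\<kappa> + \<delta>))
      \<le> wdeg w (poly ((pderiv ^^ i) \<Psi>) g) + Fin (ncopies i (\<kappa> + \<delta>))"
    by (simp add: add.assoc ncopies_Suc add.commute[of "ncopies i (\<kappa> + \<delta>)"])
  then show ?case using Suc.IH by (rule order_trans)
qed

text \<open>
  Differentiate m times, where m is the first index without a drop of degree. The m-th derivative of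
  \<Phi> at g has degree deg^g \<Phi> - m deg g, and each of the m steps
  from a derivative back to the polynomial before it adds at least M + deg g.
\<close>

lemma shestakov_umirbaev_inequality:
  assumes \<Phi>: "\<Phi> \<in> polys_over (subalg (set fs))" "\<Phi> \<noteq> 0"
  shows "wdeg_at w g \<Phi> + ncopies (m_at w g \<Phi>) M \<le> wdeg w (poly \<Phi> g)"
proof -
  obtain \<mu> where \<mu>: "wdeg_at w g \<Phi> = Fin \<mu>" using wdeg_at_nonzeroE[OF g \<Phi>(2)] .
  define m where "m = m_at w g \<Phi>"
  have m: "wdeg w (poly ((pderiv ^^ m) \<Phi>) g) = Fin (\<mu> - ncopies m \<delta>)"
    unfolding m_def m_at_eq_order[OF g \<mu>] by (rule wdeg_pderivs_order[OF g \<mu>])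
  show ?thesis
    unfolding m_def[symmetric] \<mu>
  proof (cases rule: defect_cases)
    case 1
    \<comment> \<open>For m = 0 the multiple of \<open>Minf\<close> is 0, and the bound holds because nothing dropped.\<close>
    then show "Fin \<mu> + ncopies m M \<le> wdeg w (poly \<Phi> g)"
      using m by (cases "m = 0") (simp_all add: ncopies_Minf zero_extended_def)
  next
    case (2 \<kappa>)
    have "wdeg w (poly ((pderiv ^^ m) \<Phi>) g) + Fin (ncopies m (\<kappa> + \<delta>)) \<le> wdeg w (poly \<Phi> g)"
      by (rule wdeg_pderivs_plus_defect_le[OF \<Phi>(1) 2(1)])
    then show "Fin \<mu> + ncopies m M \<le> wdeg w (poly \<Phi> g)"
      unfolding m 2(1) by (simp add: ncopies_plus algebra_simps)
  qed
qed

lemma ncopies_defect_antimono: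
  assumes "i \<le> j"
  shows "ncopies j M \<le> ncopies i M"
proof (cases rule: defect_cases)
  case 1
  then show ?thesis using assms by (cases "j = 0") (simp_all add: ncopies_Minf)
next
  case (2 \<kappa>)
  then show ?thesis using ncopies_antimono_nonpos[OF assms, of \<kappa>] by simp
qed

end

lemma wdeg_at_power:
  fixes P :: "('n::{finite,linorder}, 'k::field_char_0) mpol poly"
  assumes g: "wdeg w g = Fin \<delta>" and P: "wdeg_at w g P = Fin \<pi>"
  shows "wdeg_at w g (P ^ m) = Fin (ncopies m \<pi>)"
proof (induction m)
  case 0
  have "ycomp w \<delta> 0 (1 :: ('n, 'k) mpol poly) = 1"
  proof (rule poly_eqI)
    fix i
    have "wcomp w 0 1 = (1 :: ('n, 'k) mpol)" by (rule wcomp_homogeneous) simp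
    then show "Polynomial.coeff (ycomp w \<delta> 0 (1 :: ('n, 'k) mpol poly)) i = Polynomial.coeff 1 i"
      by (simp add: coeff_ycomp coeff_1)
  qed
  moreover have "ydeg_le w \<delta> 0 (1 :: ('n, 'k) mpol poly)"
    by (auto simp: ydeg_le_def coeff_1)
  ultimately show ?case by (simp add: wdeg_at_eq_iff[OF g])
next
  case (Suc m)
  then show ?case using wdeg_at_mult[OF g P Suc] by (simp add: ncopies_Suc add.commute)
qed

section \<open>The two lower bounds\<close>

theorem theorem3p3:
  fixes fs :: "('n::{finite,linorder}, 'k::field_char_0) mpol list"
    and g :: "('n, 'k) mpol"
    and w :: "'n \<Rightarrow> 'v::linordered_ab_group_add"
    and \<Phi> :: "('n, 'k) mpol poly"
  defines "A \<equiv> subalg (set fs)"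
    and "\<omega> \<equiv> wedge_differentials fs"
  defines "Aw \<equiv> initial_algebra w A"
    and "gw \<equiv> init_form w g"
    and "M \<equiv> form_wdeg w (wedge \<omega> (differential g)) - form_wdeg w \<omega> - wdeg w g"
  defines "Kw \<equiv> frac_field Aw"
    and "gw' \<equiv> Fraction_Field.Fract gw 1"
  defines "d \<equiv> adjoin_degree Kw gw'"
  defines "a \<equiv> Polynomial.degree \<Phi> div d"
    and "b \<equiv> Polynomial.degree \<Phi> mod d"
  assumes "length fs \<ge> 1"
    and "\<forall>f\<in>set fs. f \<noteq> 0"
    and "g \<noteq> 0"
    and "alg_independent fs"
    and "\<forall>h\<in>A - {0}. wdeg w h \<ge> 0"
    and "\<Phi> \<in> polys_over A - {0}"
  shows "(algebraic_over Kw gw' \<longrightarrow>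
            wdeg w (poly \<Phi> g) \<ge> ncopies (Polynomial.degree \<Phi>) (wdeg w g) + ncopies a M \<and>
            ncopies (Polynomial.degree \<Phi>) (wdeg w g) + ncopies a M
              = ncopies a (ncopies d (wdeg w g) + M) + ncopies b (wdeg w g)) \<and>
         (principal_in Aw (subst_kernel Aw gw) \<and> wdeg w g \<ge> 0 \<longrightarrow>
            (\<forall>P. generates_in Aw P (subst_kernel Aw gw) \<longrightarrow>
               wdeg w (poly \<Phi> g) \<ge> ncopies (m_at w g \<Phi>) (wdeg_at w g P + M)))"
proof -
  note nonneg = \<open>\<forall>h\<in>A - {0}. wdeg w h \<ge> 0\<close>
  have \<Phi>: "\<Phi> \<in> polys_over A" "\<Phi> \<noteq> 0" using \<open>\<Phi> \<in> polys_over A - {0}\<close> by auto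
  obtain \<delta> where \<delta>: "wdeg w g = Fin \<delta>" using \<open>g \<noteq> 0\<close> by (rule wdeg_nonzeroE)
  obtain \<mu> where \<mu>: "wdeg_at w g \<Phi> = Fin \<mu>" using wdeg_at_nonzeroE[OF \<delta> \<Phi>(2)] .
  \<comment> \<open>Algebraic independence enters only here: it makes the degree of \<omega> finite.\<close>
  obtain L where "\<omega> L \<noteq> 0" using jacobian_criterion[OF \<open>alg_independent fs\<close>] unfolding \<omega>_def by blast
  then obtain \<sigma> where \<sigma>: "form_wdeg w (wedge_differentials fs) = Fin \<sigma>"
    unfolding \<omega>_def by (rule form_wdeg_nonzeroE)
  let ?n = "Polynomial.degree \<Phi>"
  define m where "m = m_at w g \<Phi>"
  define \<Psi> where "\<Psi> = ycomp w \<delta> \<mu> \<Phi>"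
  have le: "ydeg_le w \<delta> \<mu> \<Phi>" and \<Psi>0: "\<Psi> \<noteq> 0" using \<mu> wdeg_at_eq_iff[OF \<delta>] by (auto simp: \<Psi>_def)
  have Aw: "is_subring Aw" unfolding Aw_def by (rule initial_algebra_subring)
  have \<Psi>: "\<Psi> \<in> polys_over Aw" unfolding \<Psi>_def Aw_def by (rule ycomp_over_initial_algebra[OF \<Phi>(1) le])
  have ord: "m = order gw \<Psi>" unfolding m_def gw_def \<Psi>_def by (rule m_at_eq_order[OF \<delta> \<mu>])
  have SU: "Fin \<mu> + ncopies m M \<le> wdeg w (poly \<Phi> g)"
    using shestakov_umirbaev_inequality[OF \<delta> \<sigma> \<Phi>(1)[unfolded A_def] \<Phi>(2)]
    unfolding m_def M_def \<omega>_def \<mu> .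
  have "lead_coeff \<Phi> \<in> A - {0}" using \<Phi> by (auto intro: polys_over_coeff)
  then have n\<mu>: "ncopies ?n \<delta> \<le> \<mu>" using nonneg by (intro leading_summand_le[OF le]) blast
  have i: "wdeg w (poly \<Phi> g) \<ge> ncopies ?n (wdeg w g) + ncopies a M \<and>
      ncopies ?n (wdeg w g) + ncopies a M = ncopies a (ncopies d (wdeg w g) + M) + ncopies b (wdeg w g)"
    if alg: "algebraic_over Kw gw'"
  proof
    note bounds = adjoin_degree_frac_field_bounds[OF Aw alg[unfolded Kw_def gw'_def]]
    have "d \<ge> 1" unfolding d_def Kw_def gw'_def by (rule bounds(1))
    have "m * d \<le> ?n"
    proof (cases "m = 0")
      case False
      then have "poly \<Psi> gw = 0" by (simp add: ord order_root)
      then obtain q where q: "minimal_vanishing Aw gw q" using minimal_vanishing_exists[OF \<Psi> \<Psi>0] by blast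
      then have "d \<le> Polynomial.degree q"
        unfolding d_def Kw_def gw'_def by (intro bounds(2)) (auto simp: minimal_vanishing_def)
      then have "m * d \<le> m * Polynomial.degree q" by simp
      also have "\<dots> \<le> Polynomial.degree \<Psi>" unfolding ord by (rule order_times_degree_le[OF Aw q \<Psi> \<Psi>0])
      also have "\<dots> \<le> ?n" unfolding \<Psi>_def by (rule degree_ycomp_le)
      finally show ?thesis .
    qed simp
    then have "m \<le> a" using \<open>d \<ge> 1\<close> by (simp add: a_def less_eq_div_iff_mult_less_eq)
    then have "ncopies a M \<le> ncopies m M"
      unfolding M_def \<omega>_def by (rule ncopies_defect_antimono[OF \<delta> \<sigma>])
    then have "Fin (ncopies ?n \<delta>) + ncopies a M \<le> Fin \<mu> + ncopies m M"
      using n\<mu> by (intro add_mono) simp_all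
    then show "ncopies ?n (wdeg w g) + ncopies a M \<le> wdeg w (poly \<Phi> g)"
      unfolding \<delta> ncopies_Fin using SU by (rule order_trans)
    have "ncopies ?n (wdeg w g) = ncopies (a * d + b) (wdeg w g)"
      by (simp add: a_def b_def)
    then show "ncopies ?n (wdeg w g) + ncopies a M = ncopies a (ncopies d (wdeg w g) + M) + ncopies b (wdeg w g)"
      by (simp add: ncopies_add ncopies_mult ncopies_plus ac_simps)
  qed
  have ii: "ncopies (m_at w g \<Phi>) (wdeg_at w g P + M) \<le> wdeg w (poly \<Phi> g)"
    if g0: "wdeg w g \<ge> 0" and P: "generates_in Aw P (subst_kernel Aw gw)" for P
  proof (cases "m = 0")
    case True
    have "0 \<le> \<delta>" using g0 by (simp add: \<delta> zero_extended_def)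
    from ncopies_nonneg[OF this, of ?n] n\<mu> have "0 \<le> \<mu>" by (rule order_trans)
    then have "0 \<le> Fin \<mu>" by (simp add: zero_extended_def)
    then show ?thesis using SU True unfolding m_def by simp
  next
    case False
    then have "poly \<Psi> gw = 0" by (simp add: ord order_root)
    then have "\<Psi> \<in> subst_kernel Aw gw" using \<Psi> by (simp add: subst_kernel_def)
    \<comment> \<open>A positive multiplicity is a nontrivial relation, so the generator is not 0.\<close>
    then have P0: "P \<noteq> 0" using P \<Psi>0 by (auto simp: generates_in_def)
    obtain Q where Q: "Q \<in> polys_over Aw" "\<Psi> = P ^ m * Q"
      using generator_power_factor[OF Aw P P0 \<Psi> \<Psi>0] unfolding ord by blast
    then have Q0: "Q \<noteq> 0" using \<Psi>0 by auto
    obtain \<pi> where \<pi>: "wdeg_at w g P = Fin \<pi>" using wdeg_at_nonzeroE[OF \<delta> P0] .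
    obtain \<kappa> where \<kappa>: "wdeg_at w g Q = Fin \<kappa>" using wdeg_at_nonzeroE[OF \<delta> Q0] .
    have "wdeg_at w g \<Psi> = Fin (ncopies m \<pi> + \<kappa>)"
      unfolding Q(2) by (rule wdeg_at_mult[OF \<delta> wdeg_at_power[OF \<delta> \<pi>] \<kappa>])
    moreover have "wdeg_at w g \<Psi> = Fin \<mu>"
      using \<Psi>0 by (simp add: wdeg_at_eq_iff[OF \<delta>] \<Psi>_def ydeg_le_ycomp ycomp_ycomp)
    ultimately have "\<mu> = ncopies m \<pi> + \<kappa>" by simp
    moreover have "0 \<le> \<kappa>"
    proof -
      have "wdeg w (lead_coeff Q) \<ge> 0"
        using polys_over_coeff[OF Q(1)] Q0 unfolding Aw_def
        by (intro wdeg_initial_algebra_nonneg[OF nonneg]) auto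
      moreover have "ydeg_le w \<delta> \<kappa> Q" using \<kappa> wdeg_at_eq_iff[OF \<delta>] by blast
      ultimately have le: "ncopies (Polynomial.degree Q) \<delta> \<le> \<kappa>" by (intro leading_summand_le)
      have "0 \<le> \<delta>" using g0 by (simp add: \<delta> zero_extended_def)
      from ncopies_nonneg[OF this] le show ?thesis by (rule order_trans)
    qed
    ultimately have "Fin (ncopies m \<pi>) + ncopies m M \<le> Fin \<mu> + ncopies m M"
      by (intro add_right_mono) simp
    then show ?thesis
      unfolding m_def[symmetric] \<pi> ncopies_plus ncopies_Fin using SU by (rule order_trans)
  qed
  show ?thesis using i ii by blast
qed

end
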